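(* Let $\mathbb{F}$ be an algebraically closed field. Consider a nonconstant linear polynomial system matrix $$\mathcal{L}(\lambda) = \left[\begin{array}{c|cc} A(\lambda) & B(\lambda) & 0 \\ \hline -C(\lambda) & M(\lambda) & K_2(\lambda)^T \\ 0 & K_1(\lambda) & 0 \end{array}\right]\in\mathbb{F}[\lambda]^{(n+q)\times (n+r)}$$ with $n>0$ and (regular) state matrix $A(\lambda)\in\mathbb{F}[\lambda]^{n\times n}$. Let $$L(\lambda):=\begin{bmatrix} M(\lambda) & K_2(\lambda)^T \\ K_1(\lambda) & 0\end{bmatrix}$$ be a block full rank pencil, and let $N_1(\lambda)$ and $N_2(\lambda)$ be any rational bases dual to $K_1(\lambda)$ and $K_2(\lambda)$, respectively. Let $\Omega$ be a nonempty subset of $\mathbb{F}$ such that $K_i(\lambda)$ and $N_i(\lambda)$ have full row rank in $\Omega$ for $i=1,2$. If $$\operatorname{rank}\begin{bmatrix} A(\lambda_0) \\ -N_2(\lambda_0)C(\lambda_0)\end{bmatrix}=\operatorname{rank}\begin{bmatrix} A(\lambda_0) & B(\lambda_0)N_1(\lambda_0)^{T}\end{bmatrix}=n$$ for all $\lambda_0\in\Omega$, then $\mathcal{L}(\lambda)$ is a linearization, in $\Omega$ and with state matrix $A(\lambda)$, of the rational matrix $$R(\lambda)=N_2(\lambda)\,[\,M(\lambda)+C(\lambda)A(\lambda)^{-1}B(\lambda)\,]\,N_1(\lambda)^{T}.$$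
   Context: A pencil is a polynomial matrix of degree at most $1$ ("linear polynomial matrix"). A square rational matrix is regular if its determinant is not identically zero. Let $\Omega\subseteq\mathbb{F}$ be nonempty. A rational matrix is defined in $\Omega$ if its entries (as irreducible fractions) have no poles in $\Omega$. A square rational matrix $T(\lambda)$ is invertible in $\Omega$ if it is defined in $\Omega$ and $\det T(\lambda_0)\ne 0$ for all $\lambda_0\in\Omega$. A $p\times m$ rational matrix has full row rank in $\Omega$ if it is defined in $\Omega$ and has rank $p$ at every $\lambda_0\in\Omega$. Polynomial system matrix: a polynomial matrix $P(\lambda)=\begin{bmatrix}A(\lambda)&B(\lambda)\\ -C(\lambda)&D(\lambda)\end{bmatrix}$ with $A(\lambda)\in\mathbb{F}[\lambda]^{n\times n}$ regular (the state matrix); its transfer function matrix is $D(\lambda)+C(\lambda)A(\lambda)^{-1}B(\lambda)$. It is minimal in $\Omega$ if $\operatorname{rank}\begin{bmatrix}A(\lambda_0)\\ C(\lambda_0)\end{bmatrix}=\operatorname{rank}\begin{bmatrix}A(\lambda_0)&B(\lambda_0)\end{bmatrix}=n$ for all $\lambda_0\in\Omega$. In the claim, the partition of $\mathcal{L}(\lambda)$ as a polynomial system matrix is the one indicated by the lines. Linearization in $\Omega$: a linear polynomial system matrix $\mathcal{L}(\lambda)\in\mathbb{F}[\lambda]^{(n+q)\times(n+r)}$ with state matrix $A(\lambda)$ and transfer function matrix $\widehat G(\lambda)\in\mathbb{F}(\lambda)^{q\times r}$ is a linearization of $G(\lambda)\in\mathbb{F}(\lambda)^{p\times m}$ in $\Omega$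 (with state matrix $A(\lambda)$) if (a) $\mathcal{L}(\lambda)$ is minimal in $\Omega$, and (b) there exist nonnegative integers $s_1,s_2$ with $s_1-s_2=q-p=r-m$ and rational matrices $R_1(\lambda)\in\mathbb{F}(\lambda)^{(p+s_1)\times(p+s_1)}$, $R_2(\lambda)\in\mathbb{F}(\lambda)^{(m+s_1)\times(m+s_1)}$ invertible in $\Omega$ such that $R_1(\lambda)\operatorname{diag}(G(\lambda),I_{s_1})R_2(\lambda)=\operatorname{diag}(\widehat G(\lambda),I_{s_2})$. Block full rank pencil: a linear polynomial matrix of the form $\begin{bmatrix} M(\lambda)&K_2(\lambda)^T\\ K_1(\lambda)&0\end{bmatrix}$ where $K_1(\lambda)$ and $K_2(\lambda)$ are pencils with full row normal rank (i.e. full row rank over the field $\mathbb{F}(\lambda)$); $K_1$ or $K_2$ may be empty. A rational basis is a rational matrix with full row normal rank. Two rational matrices $G(\lambda)\in\mathbb{F}(\lambda)^{p\times m}$ and $H(\lambda)\in\mathbb{F}(\lambda)^{q\times m}$ are dual rational bases if both have full row normal rank, $p+q=m$ and $G(\lambda)H(\lambda)^T=0$. If $K_1$ (resp. $K_2$) is empty, $N_1$ (resp. $N_2$) may be taken to be any rational matrix invertible in $\Omega$ whose size is the number of columns (resp. rows) of $M(\lambda)$. *)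

theory Defs
  imports
    "HOL-Computational_Algebra.Polynomial_Factorial"
    "Jordan_Normal_Form.Gauss_Jordan_Elimination"
    "Jordan_Normal_Form.DL_Rank"
begin

text \<open>Rational functions over a field are elements of \<open>'a poly fract\<close>. They are
  evaluated through an irreducible fraction.\<close>

definition reduced_fraction :: "'a::field poly fract \<Rightarrow> 'a poly \<times> 'a poly" where
  "reduced_fraction x = (SOME (p, q). q \<noteq> 0 \<and> coprime p q \<and> x = Fract p q)"

definition ratfun_defined_at :: "'a::field poly fract \<Rightarrow> 'a \<Rightarrow> bool" where
  "ratfun_defined_at x l \<longleftrightarrow> poly (snd (reduced_fraction x)) l \<noteq> 0"

definition ratfun_eval :: "'a::field poly fract \<Rightarrow> 'a \<Rightarrow> 'a" where
  "ratfun_eval x l = poly (fst (reduced_fraction x)) l / poly (snd (reduced_fraction x)) l"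

lemma reduced_fraction_exists:
  fixes x :: "'a::field poly fract"
  shows "\<exists>p q. q \<noteq> 0 \<and> coprime p q \<and> x = Fract p q"
proof -
  let ?P = "\<lambda>(p, q). q \<noteq> 0 \<and> x = Fract p q"
  have "\<exists>z. ?P z" by (cases x) auto
  then obtain z where z: "?P z" and min: "\<And>y. ?P y \<Longrightarrow> degree (snd z) \<le> degree (snd y)"
    using ex_has_least_nat[of ?P _ "\<lambda>y. degree (snd y)"] by blast
  obtain p q where zpq: "z = (p, q)" by (cases z)
  have q: "q \<noteq> 0" and x: "x = Fract p q" using z zpq by auto
  have "coprime p q"
  proof (rule coprimeI)
    fix c assume "c dvd p" "c dvd q"
    then obtain p' q' where p': "p = c * p'" and q': "q = c * q'" by (auto elim!: dvdE)
    have nz: "c \<noteq> 0" "q' \<noteq> 0" using q q' by auto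
    have "x = Fract p' q'" using x p' q' nz by (simp add: eq_fract mult_ac)
    then have "degree q \<le> degree q'" using min[of "(p', q')"] nz zpq by simp
    then have "degree c = 0" using q' nz by (simp add: degree_mult_eq)
    then show "is_unit c" using nz by (simp add: is_unit_iff_degree)
  qed
  then show ?thesis using q x by blast
qed

lemma reduced_fraction:
  "snd (reduced_fraction x) \<noteq> 0" (is ?A)
  "coprime (fst (reduced_fraction x)) (snd (reduced_fraction x))" (is ?B)
  "x = Fract (fst (reduced_fraction x)) (snd (reduced_fraction x))" (is ?C)
proof -
  have "case reduced_fraction x of (p, q) \<Rightarrow> q \<noteq> 0 \<and> coprime p q \<and> x = Fract p q"
    unfolding reduced_fraction_def by (rule someI_ex) (use reduced_fraction_exists[of x] in auto)
  then show ?A ?B ?C by (auto simp: case_prod_beta)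
qed

lemma ratfun_Fract:
  assumes "poly q l \<noteq> 0"
  shows "ratfun_defined_at (Fract p q) l" "ratfun_eval (Fract p q) l = poly p l / poly q l"
proof -
  define u v where "u = fst (reduced_fraction (Fract p q))"
    and "v = snd (reduced_fraction (Fract p q))"
  have v: "v \<noteq> 0" "coprime u v" "Fract p q = Fract u v"
    using reduced_fraction[of "Fract p q"] by (auto simp: u_def v_def)
  have "q \<noteq> 0" using assms by auto
  then have "p * v = u * q" using v by (simp add: eq_fract)
  then have eq: "poly p l * poly v l = poly u l * poly q l"
    by (metis poly_mult)
  have nz: "poly v l \<noteq> 0"
  proof
    assume "poly v l = 0"
    then have "poly u l = 0" using eq assms by simp
    then have "is_unit [:-l, 1:]"
      using \<open>poly v l = 0\<close> v(2) by (meson coprime_common_divisor poly_eq_0_iff_dvd)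
    then show False by (simp add: is_unit_iff_degree)
  qed
  then show "ratfun_defined_at (Fract p q) l" by (simp add: ratfun_defined_at_def v_def)
  show "ratfun_eval (Fract p q) l = poly p l / poly q l"
    using eq nz assms by (simp add: ratfun_eval_def u_def[symmetric] v_def[symmetric] field_simps)
qed


definition rat_of_polymat :: "'a::field poly mat \<Rightarrow> 'a poly fract mat" where
  "rat_of_polymat P = map_mat to_fract P"

definition polymat_eval :: "'a::field poly mat \<Rightarrow> 'a \<Rightarrow> 'a mat" where
  "polymat_eval P l = map_mat (\<lambda>p. poly p l) P"

definition ratmat_eval :: "'a::field poly fract mat \<Rightarrow> 'a \<Rightarrow> 'a mat" where
  "ratmat_eval T l = map_mat (\<lambda>x. ratfun_eval x l) T"

definition linear_polymat :: "'a::field poly mat \<Rightarrow> bool" where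
  "linear_polymat P \<longleftrightarrow> (\<forall>i < dim_row P. \<forall>j < dim_col P. degree (P $$ (i, j)) \<le> 1)"

definition nonconstant_polymat :: "'a::field poly mat \<Rightarrow> bool" where
  "nonconstant_polymat P \<longleftrightarrow> (\<exists>i < dim_row P. \<exists>j < dim_col P. degree (P $$ (i, j)) \<noteq> 0)"

definition mat_rank :: "'a::field mat \<Rightarrow> nat" where
  "mat_rank A = vec_space.rank (dim_row A) A"

definition append_cols :: "'a::zero mat \<Rightarrow> 'a mat \<Rightarrow> 'a mat" (infixr "@\<^sub>c" 65) where
  "A @\<^sub>c B = four_block_mat A B (0\<^sub>m 0 (dim_col A)) (0\<^sub>m 0 (dim_col B))"

definition regular_mat :: "'a::comm_ring_1 mat \<Rightarrow> bool" where
  "regular_mat A \<longleftrightarrow> square_mat A \<and> det A \<noteq> 0"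

definition full_row_normal_rank :: "'a::field poly fract mat \<Rightarrow> bool" where
  "full_row_normal_rank T \<longleftrightarrow> mat_rank T = dim_row T"

definition ratmat_defined_in :: "'a::field set \<Rightarrow> 'a poly fract mat \<Rightarrow> bool" where
  "ratmat_defined_in \<Omega> T \<longleftrightarrow>
     (\<forall>i < dim_row T. \<forall>j < dim_col T. \<forall>l \<in> \<Omega>. ratfun_defined_at (T $$ (i, j)) l)"

definition ratmat_invertible_in :: "'a::field set \<Rightarrow> 'a poly fract mat \<Rightarrow> bool" where
  "ratmat_invertible_in \<Omega> T \<longleftrightarrow>
     square_mat T \<and> ratmat_defined_in \<Omega> T \<and> (\<forall>l \<in> \<Omega>. ratfun_eval (det T) l \<noteq> 0)"

definition full_row_rank_in :: "'a::field set \<Rightarrow> 'a poly fract mat \<Rightarrow> bool" where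
  "full_row_rank_in \<Omega> T \<longleftrightarrow>
     ratmat_defined_in \<Omega> T \<and> (\<forall>l \<in> \<Omega>. mat_rank (ratmat_eval T l) = dim_row T)"

definition rational_basis :: "'a::field poly fract mat \<Rightarrow> bool" where
  "rational_basis T \<longleftrightarrow> full_row_normal_rank T"

text \<open>If \<open>H\<close> is empty (no rows), this leaves \<open>G\<close> as an arbitrary
  square matrix of full row normal rank; requiring full row rank of \<open>G\<close> in a set then
  makes it an arbitrary matrix invertible in that set.\<close>

definition dual_rational_bases :: "'a::field poly fract mat \<Rightarrow> 'a poly fract mat \<Rightarrow> bool" where
  "dual_rational_bases G H \<longleftrightarrow>
     rational_basis G \<and> rational_basis H \<and> dim_col G = dim_col H \<and>
     dim_row G + dim_row H = dim_col G \<and>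
     G * transpose_mat H = 0\<^sub>m (dim_row G) (dim_row H)"


definition polynomial_system_matrix ::
  "'a::field poly mat \<Rightarrow> 'a poly mat \<Rightarrow> 'a poly mat \<Rightarrow> 'a poly mat \<Rightarrow> 'a poly mat \<Rightarrow> bool" where
  "polynomial_system_matrix P A B C D \<longleftrightarrow>
     regular_mat A \<and>
     B \<in> carrier_mat (dim_row A) (dim_col D) \<and> C \<in> carrier_mat (dim_row D) (dim_row A) \<and>
     P = four_block_mat A B (- C) D"

text \<open>\<open>mat_inverse\<close> returns \<open>Some\<close> inverse whenever \<open>A\<close>
  is regular, which is always assumed below.\<close>

definition transfer_function ::
  "'a::field poly mat \<Rightarrow> 'a poly mat \<Rightarrow> 'a poly mat \<Rightarrow> 'a poly mat \<Rightarrow> 'a poly fract mat" where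
  "transfer_function A B C D =
     rat_of_polymat D
       + rat_of_polymat C * the (mat_inverse (rat_of_polymat A)) * rat_of_polymat B"

definition minimal_in ::
  "'a::field set \<Rightarrow> 'a poly mat \<Rightarrow> 'a poly mat \<Rightarrow> 'a poly mat \<Rightarrow> bool" where
  "minimal_in \<Omega> A B C \<longleftrightarrow>
     (\<forall>l \<in> \<Omega>.
        mat_rank (polymat_eval A l @\<^sub>r polymat_eval C l) = dim_row A \<and>
        mat_rank (polymat_eval A l @\<^sub>c polymat_eval B l) = dim_row A)"

text \<open>The partition of \<open>L\<close>, and so \<open>B\<close>, \<open>C\<close>,
  \<open>D\<close>, is determined by \<open>L\<close> and the size of the state matrix
  \<open>A\<close>. The integers \<open>s1\<close>, \<open>s2\<close> satisfy
  \<open>s1 - s2 = q - p = r - m\<close> where \<open>G\<close> is \<open>p \<times> m\<close> and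
  \<open>D\<close> is \<open>q \<times> r\<close>.\<close>

definition is_linearization_in ::
  "'a::field set \<Rightarrow> 'a poly mat \<Rightarrow> 'a poly mat \<Rightarrow> 'a poly fract mat \<Rightarrow> bool" where
  "is_linearization_in \<Omega> L A G \<longleftrightarrow>
     (\<exists>B C D. polynomial_system_matrix L A B C D \<and> linear_polymat L \<and> minimal_in \<Omega> A B C \<and>
       (\<exists>s1 s2 R1 R2.
          int s1 - int s2 = int (dim_row D) - int (dim_row G) \<and>
          int s1 - int s2 = int (dim_col D) - int (dim_col G) \<and>
          R1 \<in> carrier_mat (dim_row G + s1) (dim_row G + s1) \<and> ratmat_invertible_in \<Omega> R1 \<and>
          R2 \<in> carrier_mat (dim_col G + s1) (dim_col G + s1) \<and> ratmat_invertible_in \<Omega> R2 \<and>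
          R1 * diag_block_mat [G, 1\<^sub>m s1] * R2
            = diag_block_mat [transfer_function A B C D, 1\<^sub>m s2]))"

definition block_full_rank_pencil ::
  "'a::field poly mat \<Rightarrow> 'a poly mat \<Rightarrow> 'a poly mat \<Rightarrow> 'a poly mat \<Rightarrow> bool" where
  "block_full_rank_pencil L M K1 K2 \<longleftrightarrow>
     dim_col K1 = dim_col M \<and> dim_col K2 = dim_row M \<and>
     L = four_block_mat M (transpose_mat K2) K1 (0\<^sub>m (dim_row K1) (dim_row K2)) \<and>
     linear_polymat L \<and>
     full_row_normal_rank (rat_of_polymat K1) \<and> full_row_normal_rank (rat_of_polymat K2)"

end

theory Submission
  imports Defs
begin

text \<open>Write \<open>Q = M + C A\<inverse> B\<close>. The transfer function of the pencil is the bordered matrix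
\<open>[Q, K2\<^sup>T; K1, 0]\<close>, and the claim is that it is equivalent to \<open>diag(R, I)\<close> with \<open>R = N2 Q N1\<^sup>T\<close>,
by transformations invertible in \<open>\<Omega>\<close>. If \<open>Q\<close> had no poles in \<open>\<Omega>\<close>, this would be block
elimination: complete \<open>N2\<close> to a square matrix \<open>[N2; \<nu>]\<close> with inverse \<open>[\<alpha>, K2\<^sup>T]\<close>, complete \<open>N1\<close>
likewise, and clear the remaining blocks of \<open>Q\<close> with the identity blocks that the borders
have become. But \<open>A\<close> may be singular at points of \<open>\<Omega>\<close>, and then the blocks to be cleared have
poles there.

The completions are not unique, and the rank hypotheses make it possible to choose them so that
the poles disappear. The column condition says that \<open>A\<close> and \<open>N2 C\<close> have no common right
divisor that degenerates in \<open>\<Omega>\<close>, so there are \<open>E\<close>, \<open>F\<close> without poles in \<open>\<Omega>\<close> with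
\<open>E A + F N2 C = I\<close>. Hence \<open>C A\<inverse> = C E + C F \<cdot> N2 C A\<inverse>\<close>: the whole singular part of
\<open>C A\<inverse>\<close> is seen through \<open>N2 C A\<inverse>\<close>. Adding to a right inverse of \<open>N2\<close> a multiple of
\<open>C F\<close> that \<open>N2\<close> annihilates gives a completion for which \<open>\<nu> C A\<inverse>\<close>, and with it \<open>\<nu> Q\<close>, has no poles in \<open>\<Omega>\<close>
(\<open>complement_regularizing_pole\<close>). The row condition gives the same on the other side, by
transposition. With these completions the elimination goes through, and its transformations
are written down together with their inverses (\<open>schur_block_equivalence\<close>).

What remains is to produce matrices without poles in \<open>\<Omega>\<close> from pointwise rank conditions. The
rational functions without poles in \<open>\<Omega>\<close> form a localization of the polynomial ring, hence a
principal ideal ring, whose nonunits all vanish somewhere in \<open>\<Omega>\<close>. A matrix over it with a right inverse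
at each point of \<open>\<Omega>\<close> therefore has one over the ring
(\<open>pointwise_imp_global_right_inverse\<close>). This yields the right inverses of \<open>N1\<close>, \<open>N2\<close>, \<open>K1\<close>, \<open>K2\<close>
and the matrices \<open>E\<close>, \<open>F\<close>. Minimality is the identity \<open>E A + (F N2) C = I\<close> and its row analogue,
evaluated at the points of \<open>\<Omega>\<close>.\<close>

section \<open>Full rank and one-sided inverses over a field\<close>

text \<open>Full rank enters the hypotheses and the minimality condition as a dimension, and is used only
through the existence of a one-sided inverse. The next lemmas translate in both directions.\<close>

lemma mat_mult_unit_vec:
  fixes X :: "'a::comm_ring_1 mat"
  assumes X: "X \<in> carrier_mat r c" and j: "j < c"
  shows "X *\<^sub>v unit_vec c j = col X j"
  using X j by (intro eq_vecI) auto

lemma independent_list_invertible: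
  fixes us :: "'a::field vec list"
  assumes "set us \<subseteq> carrier_vec r" "length us = r" "distinct us"
    and indpt: "\<not> LinearCombinations.module.lin_dep class_ring (module_vec TYPE('a) r) (set us)"
  obtains Z where "Z \<in> carrier_mat r r" "Z * mat_of_cols r us = 1\<^sub>m r" "mat_of_cols r us * Z = 1\<^sub>m r"
proof -
  interpret vec_space "TYPE('a)" r .
  let ?W = "mat_of_cols r us"
  have W: "?W \<in> carrier_mat r r" using assms(2) by auto
  have cW: "cols ?W = us" using assms(1) by simp
  have "rank ?W = r" using lin_indpt_full_rank[OF W] cW assms(3) indpt by simp
  then have "det ?W \<noteq> 0" using det_rank_iff[OF W] by simp
  then have "?W \<in> Units (ring_mat TYPE('a) r ())"
    using det_non_zero_imp_unit[OF W] by simp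
  then obtain Z where "Z \<in> carrier_mat r r" "Z * ?W = 1\<^sub>m r" "?W * Z = 1\<^sub>m r"
    unfolding Units_def by (auto simp: ring_mat_simps)
  then show ?thesis using that by blast
qed

lemma right_inverse_imp_full_row_rank:
  fixes X :: "'a::field mat"
  assumes X: "X \<in> carrier_mat r c" and Y: "Y \<in> carrier_mat c r" and XY: "X * Y = 1\<^sub>m r"
  shows "mat_rank X = r"
proof -
  interpret vec_space "TYPE('a)" r .
  have "\<exists>x\<in>carrier_vec c. X *\<^sub>v x = v" if v: "v \<in> carrier_vec r" for v
  proof (rule bexI)
    have "X *\<^sub>v (Y *\<^sub>v v) = (X * Y) *\<^sub>v v" using X Y v by simp
    then show "X *\<^sub>v (Y *\<^sub>v v) = v" using XY v by simp
  qed (use Y v in auto)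
  then have "span (set (cols X)) = carrier_vec r"
    using col_space_eq[OF X] X unfolding col_space_def by auto
  then have "rank X = vectorspace.dim class_ring (vs (carrier_vec r))"
    unfolding rank_def by simp
  also have "vs (carrier_vec r) = V" by (simp add: module_vec_def)
  also note dim_is_n
  finally have "rank X = r" .
  then show ?thesis using X by (simp add: mat_rank_def)
qed

text \<open>A maximal independent subset of the columns is a basis, so a selection matrix \<open>S\<close> turns \<open>X\<close> into
an invertible matrix \<open>X S\<close>.\<close>

lemma full_row_rank_imp_right_inverse:
  fixes X :: "'a::field mat"
  assumes X: "X \<in> carrier_mat r c" and rk: "mat_rank X = r"
  obtains Y where "Y \<in> carrier_mat c r" "X * Y = 1\<^sub>m r"
proof -
  interpret vec_space "TYPE('a)" r .
  have empty_indpt: "lin_indpt {}" by (simp add: lin_dep_def)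
  let ?P = "\<lambda>T. T \<subseteq> set (cols X) \<and> lin_indpt T"
  obtain U where U: "maximal U ?P" "finite U"
    using maximal_exists_superset[of "set (cols X)" ?P "{}"] empty_indpt by auto
  have card: "card U = r" using rank_card_indpt[OF X U(1)] rk X by (simp add: mat_rank_def)
  obtain us where us: "set us = U" "distinct us" using finite_distinct_list[OF U(2)] by blast
  have len: "length us = r" using us card distinct_card by fastforce
  have sub: "U \<subseteq> set (cols X)" "lin_indpt U" using U(1) unfolding maximal_def by auto
  have setX: "set (cols X) \<subseteq> carrier_vec r" using X cols_dim by blast
  have carr: "set us \<subseteq> carrier_vec r" using sub us setX by auto
  obtain Z where Z: "Z \<in> carrier_mat r r" "mat_of_cols r us * Z = 1\<^sub>m r"
    using independent_list_invertible[OF carr len us(2)] sub us by metis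
  have "\<forall>j<r. \<exists>k<c. col X k = us ! j"
  proof (intro allI impI)
    fix j assume "j < r"
    then have "us ! j \<in> set (cols X)" using sub us len nth_mem by blast
    then show "\<exists>k<c. col X k = us ! j" using X by (auto simp: cols_def)
  qed
  then obtain f where f: "\<And>j. j < r \<Longrightarrow> f j < c \<and> col X (f j) = us ! j" by metis
  define S :: "'a mat" where "S = mat_of_cols c (map (\<lambda>j. unit_vec c (f j)) [0..<r])"
  have S: "S \<in> carrier_mat c r" unfolding S_def by (rule carrier_matI) simp_all
  have "X * S = mat_of_cols r us"
  proof (rule mat_col_eqI)
    fix j assume "j < dim_col (mat_of_cols r us)"
    then have j: "j < r" using len by simp
    have "col S j = unit_vec c (f j)" using j by (simp add: S_def col_mat_of_cols)
    then have "col (X * S) j = X *\<^sub>v unit_vec c (f j)" using col_mult2[OF X S j] by simp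
    also have "\<dots> = col X (f j)" using mat_mult_unit_vec[OF X] f[OF j] by simp
    also have "\<dots> = col (mat_of_cols r us) j" using f[OF j] j len carr
      by (simp add: col_mat_of_cols subset_code(1))
    finally show "col (X * S) j = col (mat_of_cols r us) j" .
  qed (use X S len in auto)
  then have "X * (S * Z) = 1\<^sub>m r" using assoc_mult_mat[OF X S Z(1)] Z(2) by simp
  then show ?thesis using that[of "S * Z"] S Z(1) by auto
qed

lemma left_inverse_imp_full_column_rank:
  fixes X :: "'a::field mat"
  assumes X: "X \<in> carrier_mat r c" and Y: "Y \<in> carrier_mat c r" and YX: "Y * X = 1\<^sub>m c"
  shows "mat_rank X = c"
proof -
  interpret vec_space "TYPE('a)" r .
  have inj: "v = w" if "v \<in> carrier_vec c" "w \<in> carrier_vec c" "X *\<^sub>v v = X *\<^sub>v w" for v w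
  proof -
    have "Y *\<^sub>v (X *\<^sub>v v) = Y *\<^sub>v (X *\<^sub>v w)" using that(3) by simp
    then show ?thesis using that(1,2) X Y YX
      by (metis assoc_mult_mat_vec one_mult_mat_vec)
  qed
  have dist: "distinct (cols X)"
  proof (unfold distinct_conv_nth, intro allI impI)
    fix i j assume ij: "i < length (cols X)" "j < length (cols X)" "i \<noteq> j"
    then have lt: "i < c" "j < c" using X by auto
    have "unit_vec c i \<noteq> (unit_vec c j :: 'a vec)"
      using ij(3) lt by (simp add: unit_vec_eq)
    then have "X *\<^sub>v unit_vec c i \<noteq> X *\<^sub>v unit_vec c j"
      using inj[of "unit_vec c i" "unit_vec c j"] by auto
    then show "cols X ! i \<noteq> cols X ! j" using mat_mult_unit_vec[OF X] lt X by auto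
  qed
  have "lin_indpt (set (cols X))"
  proof
    assume "lin_dep (set (cols X))"
    from lin_depE[OF X this dist] obtain v
      where v: "v \<in> carrier_vec c" "v \<noteq> 0\<^sub>v c" "X *\<^sub>v v = 0\<^sub>v r" by metis
    moreover have "X *\<^sub>v 0\<^sub>v c = 0\<^sub>v r" using X by auto
    ultimately show False using inj[of v "0\<^sub>v c"] by simp
  qed
  then have "rank X = c" using lin_indpt_full_rank[OF X dist] by simp
  then show ?thesis using X by (simp add: mat_rank_def)
qed

text \<open>The columns are independent, and unit vectors extend them to a basis. The inverse of the
matrix with that basis as columns has a left inverse of \<open>X\<close> as its first \<open>c\<close> rows.\<close>

lemma full_column_rank_imp_left_inverse:
  fixes X :: "'a::field mat"
  assumes X: "X \<in> carrier_mat r c" and rk: "mat_rank X = c"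
  obtains Y where "Y \<in> carrier_mat c r" "Y * X = 1\<^sub>m c"
proof -
  interpret vec_space "TYPE('a)" r .
  have rkX: "rank X = c" using rk X by (simp add: mat_rank_def)
  have setX: "set (cols X) \<subseteq> carrier_vec r" using X cols_dim by blast
  have empty_indpt: "lin_indpt {}" by (simp add: lin_dep_def)
  obtain S where S: "maximal S (\<lambda>T. T \<subseteq> set (cols X) \<and> lin_indpt T)"
    using maximal_exists_superset[of "set (cols X)" "\<lambda>T. T \<subseteq> set (cols X) \<and> lin_indpt T" "{}"]
      empty_indpt by auto
  then have "S \<subseteq> set (cols X)" "card S = c"
    using rank_card_indpt[OF X S] rkX unfolding maximal_def by auto
  then have "c \<le> card (set (cols X))" using card_mono[of "set (cols X)" S] by simp
  then have dist: "distinct (cols X)" using X card_length[of "cols X"]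
    by (intro card_distinct) simp
  have li: "lin_indpt (set (cols X))" using full_rank_lin_indpt[OF X rkX dist] .
  define W where "W = mat_of_cols r (cols X @ unit_vecs r)"
  have "length (cols X @ unit_vecs r) = c + r"
    using X unit_vecs_length by (metis carrier_matD(2) cols_length length_append)
  then have W: "W \<in> carrier_mat r (c + r)" unfolding W_def by (metis mat_of_cols_carrier(1))
  have sub: "set (cols X) \<union> set (unit_vecs r) \<subseteq> carrier_vec r"
    using setX unit_vecs_carrier by blast
  have cW: "cols W = cols X @ unit_vecs r" unfolding W_def by (rule cols_mat_of_cols) (use sub in simp)
  let ?P = "\<lambda>T. T \<subseteq> set (cols W) \<and> lin_indpt T"
  obtain U where U: "maximal U ?P" "finite U" "set (cols X) \<subseteq> U"
    using maximal_exists_superset[of "set (cols W)" ?P "set (cols X)"] li cW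
    by auto
  have "span (set (cols W)) = carrier_vec r"
  proof -
    have "set (unit_vecs r) \<subseteq> set (cols W)" using cW by simp
    then have "span (set (unit_vecs r)) \<subseteq> span (set (cols W))" by (rule span_is_monotone)
    moreover have "span (set (unit_vecs r)) = carrier_vec r"
      by (rule span_unit_vecs_is_carrier)
    moreover have "span (set (cols W)) \<subseteq> carrier_vec r"
      using span_is_subset2[of "set (cols W)"] sub cW by simp
    ultimately show ?thesis by simp
  qed
  then have "rank W = vectorspace.dim class_ring (vs (carrier_vec r))"
    unfolding rank_def by simp
  also have "vs (carrier_vec r) = V" by (simp add: module_vec_def)
  also note dim_is_n
  finally have "rank W = r" .
  then have card: "card U = r" using rank_card_indpt[OF W U(1)] by simp
  obtain es where es: "set es = U - set (cols X)" "distinct es"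
    using finite_distinct_list[of "U - set (cols X)"] U(2) by auto
  let ?us = "cols X @ es"
  have setus: "set ?us = U" using es U(3) by auto
  have d: "distinct ?us" using dist es by auto
  have len: "length ?us = r" using distinct_card[OF d] setus card by simp
  have carr: "set ?us \<subseteq> carrier_vec r" using setus U(1) sub cW unfolding maximal_def by auto
  have liU: "lin_indpt (set ?us)" using U(1) setus unfolding maximal_def by simp
  obtain Z where Z: "Z \<in> carrier_mat r r" "Z * mat_of_cols r ?us = 1\<^sub>m r"
    using independent_list_invertible[OF carr len d liU] by metis
  have cr: "c \<le> r" using len X by simp
  define Y where "Y = mat c r (\<lambda>(i,j). Z $$ (i,j))"
  have Y: "Y \<in> carrier_mat c r" by (simp add: Y_def)
  have "Y * X = 1\<^sub>m c"
  proof (rule eq_matI)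
    fix i j assume "i < dim_row (1\<^sub>m c :: 'a mat)" "j < dim_col (1\<^sub>m c :: 'a mat)"
    then have ij: "i < c" "j < c" by auto
    have "row Y i = row Z i" using ij cr Z(1) by (intro eq_vecI) (auto simp: Y_def)
    moreover have "col (mat_of_cols r ?us) j = col X j"
      using ij X len carr by (subst col_mat_of_cols) (auto simp: nth_append)
    ultimately have "(Y * X) $$ (i,j) = (Z * mat_of_cols r ?us) $$ (i,j)"
      using ij cr X Y Z(1) len by simp
    then show "(Y * X) $$ (i,j) = 1\<^sub>m c $$ (i,j)" using Z(2) ij cr by simp
  qed (use X Y in auto)
  then show ?thesis using that Y by blast
qed

section \<open>Rational functions without a pole at a point\<close>

lemma ratfun_defined_atE:
  assumes "ratfun_defined_at x l"
  obtains p q where "poly q l \<noteq> 0" "x = Fract p q"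
  using assms reduced_fraction(3)[of x] unfolding ratfun_defined_at_def by blast

lemma ratfun_add:
  assumes "ratfun_defined_at x l" "ratfun_defined_at y l"
  shows "ratfun_defined_at (x + y) l"
    and "ratfun_eval (x + y) l = ratfun_eval x l + ratfun_eval y l"
proof -
  obtain p q where x: "poly q l \<noteq> 0" "x = Fract p q" using assms(1) by (rule ratfun_defined_atE)
  obtain r s where y: "poly s l \<noteq> 0" "y = Fract r s" using assms(2) by (rule ratfun_defined_atE)
  have nz: "q \<noteq> 0" "s \<noteq> 0" using x y by auto
  have xy: "x + y = Fract (p * s + r * q) (q * s)" using x y nz by simp
  have qs: "poly (q * s) l \<noteq> 0" using x y by simp
  show "ratfun_defined_at (x + y) l" unfolding xy by (rule ratfun_Fract[OF qs])
  show "ratfun_eval (x + y) l = ratfun_eval x l + ratfun_eval y l"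
    unfolding xy ratfun_Fract(2)[OF qs] using x y by (simp add: ratfun_Fract field_simps)
qed

lemma ratfun_mult:
  assumes "ratfun_defined_at x l" "ratfun_defined_at y l"
  shows "ratfun_defined_at (x * y) l"
    and "ratfun_eval (x * y) l = ratfun_eval x l * ratfun_eval y l"
proof -
  obtain p q where x: "poly q l \<noteq> 0" "x = Fract p q" using assms(1) by (rule ratfun_defined_atE)
  obtain r s where y: "poly s l \<noteq> 0" "y = Fract r s" using assms(2) by (rule ratfun_defined_atE)
  have xy: "x * y = Fract (p * r) (q * s)" using x y by simp
  have qs: "poly (q * s) l \<noteq> 0" using x y by simp
  show "ratfun_defined_at (x * y) l" unfolding xy by (rule ratfun_Fract[OF qs])
  show "ratfun_eval (x * y) l = ratfun_eval x l * ratfun_eval y l"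
    unfolding xy ratfun_Fract(2)[OF qs] using x y by (simp add: ratfun_Fract)
qed

lemma ratfun_to_fract [simp]:
  "ratfun_defined_at (to_fract p) l" "ratfun_eval (to_fract p) l = poly p l"
  using ratfun_Fract[of 1 l p] by (simp_all add: to_fract_def)

lemma ratfun_0_1 [simp]:
  "ratfun_defined_at 0 l" "ratfun_eval 0 l = 0" "ratfun_defined_at 1 l" "ratfun_eval 1 l = 1"
  using ratfun_to_fract[of 0 l] ratfun_to_fract[of 1 l] by simp_all

lemma ratfun_uminus:
  assumes "ratfun_defined_at x l"
  shows "ratfun_defined_at (- x) l" "ratfun_eval (- x) l = - ratfun_eval x l"
proof -
  have x: "- x = to_fract (- 1) * x" by simp
  show "ratfun_defined_at (- x) l" "ratfun_eval (- x) l = - ratfun_eval x l"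
    unfolding x using ratfun_mult[OF ratfun_to_fract(1)[of "- 1"] assms]
    by (simp_all del: to_fract_uminus)
qed

lemma ratfun_sum:
  assumes "\<And>i. i \<in> I \<Longrightarrow> ratfun_defined_at (f i) l"
  shows "ratfun_defined_at (\<Sum>i\<in>I. f i) l \<and>
    ratfun_eval (\<Sum>i\<in>I. f i) l = (\<Sum>i\<in>I. ratfun_eval (f i) l)"
  using assms by (induction I rule: infinite_finite_induct) (auto simp: ratfun_add)

lemma ratfun_prod:
  assumes "\<And>i. i \<in> I \<Longrightarrow> ratfun_defined_at (f i) l"
  shows "ratfun_defined_at (\<Prod>i\<in>I. f i) l \<and>
    ratfun_eval (\<Prod>i\<in>I. f i) l = (\<Prod>i\<in>I. ratfun_eval (f i) l)"
  using assms by (induction I rule: infinite_finite_induct) (auto simp: ratfun_mult)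

lemma ratfun_det:
  assumes T: "T \<in> carrier_mat r r"
    and d: "\<And>i j. i < r \<Longrightarrow> j < r \<Longrightarrow> ratfun_defined_at (T $$ (i, j)) l"
  shows "ratfun_defined_at (det T) l" "ratfun_eval (det T) l = det (ratmat_eval T l)"
proof -
  let ?P = "{p. p permutes {0..<r}}"
  have entry: "ratfun_defined_at (T $$ (i, p i)) l" "ratmat_eval T l $$ (i, p i) = ratfun_eval (T $$ (i, p i)) l"
    if "p \<in> ?P" "i \<in> {0..<r}" for p i
  proof -
    have "p i \<in> {0..<r}" using that permutes_in_image[of p "{0..<r}" i] by blast
    then have "p i < r" by simp
    then show "ratfun_defined_at (T $$ (i, p i)) l"
      "ratmat_eval T l $$ (i, p i) = ratfun_eval (T $$ (i, p i)) l"
      using that T d by (auto simp: ratmat_eval_def)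
  qed
  have sgn: "ratfun_defined_at (signof p) l \<and> ratfun_eval (signof p) l = signof p" for p
    using ratfun_uminus[of 1 l] by (simp add: sign_def)
  have prd: "ratfun_defined_at (\<Prod>i = 0..<r. T $$ (i, p i)) l \<and>
      ratfun_eval (\<Prod>i = 0..<r. T $$ (i, p i)) l = (\<Prod>i = 0..<r. ratmat_eval T l $$ (i, p i))"
    if "p \<in> ?P" for p
    using ratfun_prod[of "{0..<r}" "\<lambda>i. T $$ (i, p i)" l] entry[OF that] by simp
  have summand: "ratfun_defined_at (signof p * (\<Prod>i = 0..<r. T $$ (i, p i))) l \<and>
      ratfun_eval (signof p * (\<Prod>i = 0..<r. T $$ (i, p i))) l
        = signof p * (\<Prod>i = 0..<r. ratmat_eval T l $$ (i, p i))"
    if "p \<in> ?P" for p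
    using ratfun_mult[of "signof p" l "\<Prod>i = 0..<r. T $$ (i, p i)"] sgn[of p] prd[OF that] by simp
  have eT: "ratmat_eval T l \<in> carrier_mat r r" using T by (simp add: ratmat_eval_def)
  let ?f = "\<lambda>p. signof p * (\<Prod>i = 0..<r. T $$ (i, p i))"
  have s: "ratfun_defined_at (sum ?f ?P) l \<and>
      ratfun_eval (sum ?f ?P) l = (\<Sum>p\<in>?P. ratfun_eval (?f p) l)"
    by (rule ratfun_sum) (use summand in blast)
  moreover have "(\<Sum>p\<in>?P. ratfun_eval (?f p) l)
      = (\<Sum>p\<in>?P. signof p * (\<Prod>i = 0..<r. ratmat_eval T l $$ (i, p i)))"
    by (rule sum.cong[OF refl]) (use summand in blast)
  ultimately show "ratfun_defined_at (det T) l" "ratfun_eval (det T) l = det (ratmat_eval T l)"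
    unfolding det_def'[OF T] det_def'[OF eT] by simp_all
qed

section \<open>Matrices of rational functions without poles in a set\<close>

definition defined_mats :: "'a::field set \<Rightarrow> nat \<Rightarrow> nat \<Rightarrow> 'a poly fract mat set" where
  "defined_mats \<Omega> r c = {T \<in> carrier_mat r c. ratmat_defined_in \<Omega> T}"

lemma defined_matsI:
  assumes "T \<in> carrier_mat r c"
    and "\<And>i j l. i < r \<Longrightarrow> j < c \<Longrightarrow> l \<in> \<Omega> \<Longrightarrow> ratfun_defined_at (T $$ (i, j)) l"
  shows "T \<in> defined_mats \<Omega> r c"
  using assms by (auto simp: defined_mats_def ratmat_defined_in_def)

lemma defined_matsD:
  assumes "T \<in> defined_mats \<Omega> r c"
  shows "T \<in> carrier_mat r c"
    and "i < r \<Longrightarrow> j < c \<Longrightarrow> l \<in> \<Omega> \<Longrightarrow> ratfun_defined_at (T $$ (i, j)) l"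
  using assms by (auto simp: defined_mats_def ratmat_defined_in_def)

lemma defined_mats_one_zero [simp]:
  "1\<^sub>m r \<in> defined_mats \<Omega> r r" "0\<^sub>m r c \<in> defined_mats \<Omega> r c"
  by (auto intro!: defined_matsI)

lemma defined_mats_polymat:
  "P \<in> carrier_mat r c \<Longrightarrow> rat_of_polymat P \<in> defined_mats \<Omega> r c"
  by (auto intro!: defined_matsI simp: rat_of_polymat_def)

lemma defined_mats_transpose:
  "T \<in> defined_mats \<Omega> r c \<Longrightarrow> transpose_mat T \<in> defined_mats \<Omega> c r"
  using defined_matsD[of T \<Omega> r c] by (auto intro!: defined_matsI)

lemma defined_mats_uminus:
  "T \<in> defined_mats \<Omega> r c \<Longrightarrow> - T \<in> defined_mats \<Omega> r c"
  using defined_matsD[of T \<Omega> r c] by (auto intro!: defined_matsI simp: ratfun_uminus)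

lemma defined_mats_add:
  assumes "S \<in> defined_mats \<Omega> r c" "T \<in> defined_mats \<Omega> r c"
  shows "S + T \<in> defined_mats \<Omega> r c"
proof (rule defined_matsI)
  fix i j l assume "i < r" "j < c" "l \<in> \<Omega>"
  then show "ratfun_defined_at ((S + T) $$ (i, j)) l"
    using assms[THEN defined_matsD(1)] assms[THEN defined_matsD(2)] by (simp add: ratfun_add)
qed (use assms[THEN defined_matsD(1)] in auto)

lemma defined_mats_minus:
  assumes "S \<in> defined_mats \<Omega> r c" "T \<in> defined_mats \<Omega> r c"
  shows "S - T \<in> defined_mats \<Omega> r c"
proof -
  have "S - T = S + - T"
    using assms[THEN defined_matsD(1)] by (rule minus_add_uminus_mat)
  then show ?thesis using assms defined_mats_add defined_mats_uminus by metis
qed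

lemma defined_mats_smult:
  assumes "T \<in> defined_mats \<Omega> r c" "\<And>l. l \<in> \<Omega> \<Longrightarrow> ratfun_defined_at x l"
  shows "x \<cdot>\<^sub>m T \<in> defined_mats \<Omega> r c"
proof (rule defined_matsI)
  fix i j l assume "i < r" "j < c" "l \<in> \<Omega>"
  then show "ratfun_defined_at ((x \<cdot>\<^sub>m T) $$ (i, j)) l"
    using assms(2) defined_matsD[OF assms(1)] by (simp add: ratfun_mult)
qed (use defined_matsD(1)[OF assms(1)] in auto)

lemma defined_mats_mult:
  assumes S: "S \<in> defined_mats \<Omega> r n" and T: "T \<in> defined_mats \<Omega> n c"
  shows "S * T \<in> defined_mats \<Omega> r c"
    and "l \<in> \<Omega> \<Longrightarrow> ratmat_eval (S * T) l = ratmat_eval S l * ratmat_eval T l"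
proof -
  note c = defined_matsD(1)[OF S] defined_matsD(1)[OF T]
  have entry: "(S * T) $$ (i, j) = (\<Sum>k = 0..<n. S $$ (i, k) * T $$ (k, j))" if "i < r" "j < c" for i j
    using c that by (simp add: scalar_prod_def)
  have summand: "ratfun_defined_at (S $$ (i, k) * T $$ (k, j)) l"
    "ratfun_eval (S $$ (i, k) * T $$ (k, j)) l = ratfun_eval (S $$ (i, k)) l * ratfun_eval (T $$ (k, j)) l"
    if "i < r" "j < c" "k \<in> {0..<n}" "l \<in> \<Omega>" for i j k l
    using that defined_matsD(2)[OF S] defined_matsD(2)[OF T] by (simp_all add: ratfun_mult)
  show "S * T \<in> defined_mats \<Omega> r c"
  proof (rule defined_matsI)
    fix i j l assume "i < r" "j < c" "l \<in> \<Omega>"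
    then show "ratfun_defined_at ((S * T) $$ (i, j)) l"
      unfolding entry[OF \<open>i < r\<close> \<open>j < c\<close>]
      using ratfun_sum[of "{0..<n}" "\<lambda>k. S $$ (i, k) * T $$ (k, j)" l] summand(1) by simp
  qed (use c in auto)
  show "ratmat_eval (S * T) l = ratmat_eval S l * ratmat_eval T l" if l: "l \<in> \<Omega>"
  proof (rule eq_matI)
    fix i j assume "i < dim_row (ratmat_eval S l * ratmat_eval T l)"
      "j < dim_col (ratmat_eval S l * ratmat_eval T l)"
    then have ij: "i < r" "j < c" using c by (auto simp: ratmat_eval_def)
    have "ratmat_eval (S * T) l $$ (i, j) = ratfun_eval ((S * T) $$ (i, j)) l"
      using ij c by (simp add: ratmat_eval_def)
    also have "\<dots> = (\<Sum>k = 0..<n. ratfun_eval (S $$ (i, k)) l * ratfun_eval (T $$ (k, j)) l)"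
      unfolding entry[OF ij] using ratfun_sum[of "{0..<n}" "\<lambda>k. S $$ (i, k) * T $$ (k, j)" l]
        summand[OF ij _ l] by simp
    also have "\<dots> = (ratmat_eval S l * ratmat_eval T l) $$ (i, j)"
      using ij c by (simp add: ratmat_eval_def scalar_prod_def)
    finally show "ratmat_eval (S * T) l $$ (i, j) = (ratmat_eval S l * ratmat_eval T l) $$ (i, j)" .
  qed (use c in \<open>auto simp: ratmat_eval_def\<close>)
qed

lemma defined_mats_four_block:
  assumes "P \<in> defined_mats \<Omega> r1 c1" "Q \<in> defined_mats \<Omega> r1 c2"
    "R \<in> defined_mats \<Omega> r2 c1" "S \<in> defined_mats \<Omega> r2 c2"
  shows "four_block_mat P Q R S \<in> defined_mats \<Omega> (r1 + r2) (c1 + c2)"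
proof (rule defined_matsI)
  fix i j l assume "i < r1 + r2" "j < c1 + c2" "l \<in> \<Omega>"
  then show "ratfun_defined_at (four_block_mat P Q R S $$ (i, j)) l"
    using assms[THEN defined_matsD(1)] assms[THEN defined_matsD(2)] by auto
qed (use assms[THEN defined_matsD(1)] in auto)

lemma defined_mats_append_rows:
  assumes "S \<in> defined_mats \<Omega> r1 c" "T \<in> defined_mats \<Omega> r2 c"
  shows "S @\<^sub>r T \<in> defined_mats \<Omega> (r1 + r2) c"
  using defined_mats_four_block[OF assms(1) defined_mats_one_zero(2)[of r1 0] assms(2) defined_mats_one_zero(2)[of r2 0]]
    assms[THEN defined_matsD(1)] by (simp add: append_rows_def)

lemma defined_mats_append_cols:
  assumes "S \<in> defined_mats \<Omega> r c1" "T \<in> defined_mats \<Omega> r c2"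
  shows "S @\<^sub>c T \<in> defined_mats \<Omega> r (c1 + c2)"
  using defined_mats_four_block[OF assms defined_mats_one_zero(2)[of 0 c1] defined_mats_one_zero(2)[of 0 c2]]
    assms[THEN defined_matsD(1)] by (simp add: append_cols_def)

lemma defined_mats_split_cols:
  assumes X: "X \<in> defined_mats \<Omega> r (c1 + c2)"
  obtains Y Z where "Y \<in> defined_mats \<Omega> r c1" "Z \<in> defined_mats \<Omega> r c2" "X = Y @\<^sub>c Z"
proof
  note c = defined_matsD(1)[OF X]
  let ?Y = "mat r c1 (\<lambda>(i, j). X $$ (i, j))" and ?Z = "mat r c2 (\<lambda>(i, j). X $$ (i, c1 + j))"
  show "?Y \<in> defined_mats \<Omega> r c1" "?Z \<in> defined_mats \<Omega> r c2"
    using defined_matsD(2)[OF X] by (auto intro!: defined_matsI)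
  show "X = ?Y @\<^sub>c ?Z" using c by (intro eq_matI) (auto simp: append_cols_def)
qed

lemma defined_mats_split_rows:
  assumes X: "X \<in> defined_mats \<Omega> (r1 + r2) c"
  obtains Y Z where "Y \<in> defined_mats \<Omega> r1 c" "Z \<in> defined_mats \<Omega> r2 c" "X = Y @\<^sub>r Z"
proof
  note c = defined_matsD(1)[OF X]
  let ?Y = "mat r1 c (\<lambda>(i, j). X $$ (i, j))" and ?Z = "mat r2 c (\<lambda>(i, j). X $$ (r1 + i, j))"
  show "?Y \<in> defined_mats \<Omega> r1 c" "?Z \<in> defined_mats \<Omega> r2 c"
    using defined_matsD(2)[OF X] by (auto intro!: defined_matsI)
  show "X = ?Y @\<^sub>r ?Z" using c by (intro eq_matI) (auto simp: append_rows_def)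
qed

lemma ratmat_eval_one [simp]: "ratmat_eval (1\<^sub>m r) l = 1\<^sub>m r"
  by (rule eq_matI) (auto simp: ratmat_eval_def)

lemma ratmat_eval_carrier:
  "T \<in> carrier_mat r c \<Longrightarrow> ratmat_eval T l \<in> carrier_mat r c"
  by (simp add: ratmat_eval_def)

lemma ratmat_eval_polymat [simp]: "ratmat_eval (rat_of_polymat P) l = polymat_eval P l"
  by (rule eq_matI) (auto simp: ratmat_eval_def rat_of_polymat_def polymat_eval_def)

lemma ratmat_eval_transpose: "ratmat_eval (transpose_mat T) l = transpose_mat (ratmat_eval T l)"
  by (rule eq_matI) (auto simp: ratmat_eval_def)

lemma ratmat_eval_uminus:
  assumes T: "T \<in> defined_mats \<Omega> r c" and l: "l \<in> \<Omega>"
  shows "ratmat_eval (- T) l = - ratmat_eval T l"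
  using defined_matsD[OF T] l by (intro eq_matI) (auto simp: ratmat_eval_def ratfun_uminus)

lemma defined_mats_det:
  assumes T: "T \<in> defined_mats \<Omega> r r" and l: "l \<in> \<Omega>"
  shows "ratfun_defined_at (det T) l" "ratfun_eval (det T) l = det (ratmat_eval T l)"
  using ratfun_det[OF defined_matsD(1)[OF T], of l] defined_matsD(2)[OF T _ _ l] by auto

lemma defined_mats_adj:
  assumes T: "T \<in> defined_mats \<Omega> r r"
  shows "adj_mat T \<in> defined_mats \<Omega> r r"
proof (rule defined_matsI)
  note c = defined_matsD(1)[OF T]
  show "adj_mat T \<in> carrier_mat r r" by (rule adj_mat(1)[OF c])
  fix i j l assume ij: "i < r" "j < r" and l: "l \<in> \<Omega>"
  have "mat_delete T j i \<in> defined_mats \<Omega> (r - 1) (r - 1)"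
  proof (rule defined_matsI[OF mat_delete_carrier[OF c]])
    fix i' j' m assume "i' < r - 1" "j' < r - 1" "m \<in> \<Omega>"
    moreover from this have "mat_delete T j i $$ (i', j')
        = T $$ (if i' < j then i' else Suc i', if j' < i then j' else Suc j')"
      using c by (simp add: mat_delete_def)
    ultimately show "ratfun_defined_at (mat_delete T j i $$ (i', j')) m"
      using defined_matsD(2)[OF T] by simp
  qed
  then have "ratfun_defined_at (det (mat_delete T j i)) l" using l by (rule defined_mats_det)
  moreover have "ratfun_defined_at ((- 1) ^ (j + i)) l"
    using ratfun_uminus(1)[of 1 l] by (cases "even (j + i)") simp_all
  ultimately show "ratfun_defined_at (adj_mat T $$ (i, j)) l"
    using ij c by (simp add: adj_mat_def cofactor_def ratfun_mult)
qed

text \<open>The determinants of two matrices without poles that are inverse to each other multiply to \<open>1\<close>,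
and evaluation respects this product, so neither vanishes in \<open>\<Omega>\<close>. The transformations of the final
equivalence are shown to be invertible in \<open>\<Omega>\<close> in this way, from explicit inverses.\<close>

lemma ratmat_invertible_inI:
  assumes S: "S \<in> defined_mats \<Omega> r r" and T: "T \<in> defined_mats \<Omega> r r"
    and ST: "S * T = 1\<^sub>m r"
  shows "ratmat_invertible_in \<Omega> S" "ratmat_invertible_in \<Omega> T"
proof -
  have "ratfun_eval (det S) l * ratfun_eval (det T) l = 1" if l: "l \<in> \<Omega>" for l
  proof -
    have "det S * det T = 1"
      using det_mult[OF defined_matsD(1)[OF S] defined_matsD(1)[OF T]] ST by simp
    then show ?thesis
      using ratfun_mult(2)[OF defined_mats_det(1)[OF S l] defined_mats_det(1)[OF T l]] by simp
  qed
  then have "ratfun_eval (det S) l \<noteq> 0 \<and> ratfun_eval (det T) l \<noteq> 0" if "l \<in> \<Omega>" for l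
    using that by force
  then show "ratmat_invertible_in \<Omega> S" "ratmat_invertible_in \<Omega> T"
    using S T unfolding ratmat_invertible_in_def defined_mats_def by auto
qed

section \<open>From pointwise to global one-sided inverses\<close>

text \<open>A constant right inverse \<open>Y\<close> of the value \<open>T(l)\<close> makes the determinant of \<open>T Y\<close> equal to \<open>1\<close> at \<open>l\<close>, so
Cramer's rule for \<open>T Y\<close> gives a right inverse of \<open>T\<close> up to a factor that does not vanish at \<open>l\<close>.\<close>

lemma right_inverse_imp_common_denominator:
  assumes T: "T \<in> defined_mats \<Omega> r c" and l: "l \<in> \<Omega>"
    and Y: "Y \<in> carrier_mat c r" "ratmat_eval T l * Y = 1\<^sub>m r"
  obtains X d where "X \<in> defined_mats \<Omega> c r" "T * X = to_fract d \<cdot>\<^sub>m 1\<^sub>m r" "poly d l \<noteq> 0"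
proof -
  define Y0 where "Y0 = rat_of_polymat (map_mat (\<lambda>a. [:a:]) Y)"
  have Y0: "Y0 \<in> defined_mats \<Omega> c r"
    unfolding Y0_def using Y(1) by (intro defined_mats_polymat) simp
  have eY0: "ratmat_eval Y0 l = Y"
    unfolding Y0_def by (auto simp: polymat_eval_def)
  let ?E = "T * Y0"
  have E: "?E \<in> defined_mats \<Omega> r r" using defined_mats_mult(1)[OF T Y0] .
  have "ratmat_eval ?E l = 1\<^sub>m r" using defined_mats_mult(2)[OF T Y0 l] eY0 Y(2) by simp
  then have det: "ratfun_eval (det ?E) l = 1" using defined_mats_det(2)[OF E l] by simp
  \<comment> \<open>multiplication by the denominator \<open>v\<close> turns the factor \<open>det (T Y)\<close> into a polynomial\<close>
  define u v where "u = fst (reduced_fraction (det ?E))" and "v = snd (reduced_fraction (det ?E))"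
  have v: "v \<noteq> 0" and uv: "det ?E = Fract u v"
    using reduced_fraction[of "det ?E"] by (simp_all add: u_def v_def)
  have u: "poly u l \<noteq> 0" using det by (auto simp: ratfun_eval_def u_def)
  have vu: "to_fract v * det ?E = to_fract u"
    using v uv by (simp add: to_fract_def eq_fract)
  let ?X = "to_fract v \<cdot>\<^sub>m (Y0 * adj_mat ?E)"
  have adj: "adj_mat ?E \<in> defined_mats \<Omega> r r" using defined_mats_adj[OF E] .
  have X: "?X \<in> defined_mats \<Omega> c r"
    by (intro defined_mats_smult defined_mats_mult(1)[OF Y0 adj] ratfun_to_fract)
  note c = T[THEN defined_matsD(1)] Y0[THEN defined_matsD(1)] adj[THEN defined_matsD(1)]
    E[THEN defined_matsD(1)]
  have "T * ?X = to_fract v \<cdot>\<^sub>m (T * (Y0 * adj_mat ?E))"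
    using c by (intro mult_smult_distrib) auto
  also have "T * (Y0 * adj_mat ?E) = ?E * adj_mat ?E"
    using assoc_mult_mat[OF c(1,2,3)] by simp
  also have "\<dots> = det ?E \<cdot>\<^sub>m 1\<^sub>m r" by (rule adj_mat(2)[OF c(4)])
  also have "to_fract v \<cdot>\<^sub>m (det ?E \<cdot>\<^sub>m 1\<^sub>m r) = to_fract u \<cdot>\<^sub>m 1\<^sub>m r"
    using vu by (intro eq_matI) (auto simp: mult.assoc[symmetric])
  finally show ?thesis using that[OF X _ u] by simp
qed

text \<open>The polynomials \<open>d\<close> for which \<open>d I\<close> is a right multiple of \<open>T\<close> form an ideal. By the previous lemma its
elements have no common zero in \<open>\<Omega>\<close>, so its generator \<open>g\<close> has no zero in \<open>\<Omega>\<close>, and one may divide by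
\<open>g\<close> without introducing poles there.\<close>

lemma pointwise_imp_global_right_inverse:
  fixes \<Omega> :: "'a::field set"
  assumes T: "T \<in> defined_mats \<Omega> r c" and ne: "\<Omega> \<noteq> {}"
    and inv: "\<And>l. l \<in> \<Omega> \<Longrightarrow> \<exists>Y \<in> carrier_mat c r. ratmat_eval T l * Y = 1\<^sub>m r"
  obtains X where "X \<in> defined_mats \<Omega> c r" "T * X = 1\<^sub>m r"
proof -
  define I where "I = {d. \<exists>X \<in> defined_mats \<Omega> c r. T * X = to_fract d \<cdot>\<^sub>m 1\<^sub>m r}"
  have local: "\<exists>d \<in> I. poly d l \<noteq> 0" if l: "l \<in> \<Omega>" for l
    using inv[OF l] right_inverse_imp_common_denominator[OF T l] unfolding I_def by blast
  have comb: "d - s * e \<in> I" if de: "d \<in> I" "e \<in> I" for d e s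
  proof -
    obtain X where X: "X \<in> defined_mats \<Omega> c r" "T * X = to_fract d \<cdot>\<^sub>m 1\<^sub>m r"
      using de unfolding I_def by blast
    obtain Y where Y: "Y \<in> defined_mats \<Omega> c r" "T * Y = to_fract e \<cdot>\<^sub>m 1\<^sub>m r"
      using de unfolding I_def by blast
    let ?Z = "X - to_fract s \<cdot>\<^sub>m Y"
    have sY: "to_fract s \<cdot>\<^sub>m Y \<in> defined_mats \<Omega> c r"
      by (intro defined_mats_smult Y ratfun_to_fract)
    note c = T[THEN defined_matsD(1)] X(1)[THEN defined_matsD(1)] Y(1)[THEN defined_matsD(1)]
    have "T * ?Z = T * X - T * (to_fract s \<cdot>\<^sub>m Y)"
      using c by (intro mult_minus_distrib_mat) auto
    also have "T * (to_fract s \<cdot>\<^sub>m Y) = to_fract s \<cdot>\<^sub>m (T * Y)"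
      using c by (intro mult_smult_distrib) auto
    also have "T * X - to_fract s \<cdot>\<^sub>m (T * Y) = to_fract (d - s * e) \<cdot>\<^sub>m 1\<^sub>m r"
      unfolding X(2) Y(2) by (intro eq_matI) (auto simp: algebra_simps)
    finally show ?thesis using defined_mats_minus[OF X(1) sY] unfolding I_def by blast
  qed
  obtain l0 where "l0 \<in> \<Omega>" using ne by blast
  then have "\<exists>d. d \<in> I \<and> d \<noteq> 0" using local by fastforce
  then obtain g where g: "g \<in> I" "g \<noteq> 0"
    and min: "\<And>d. d \<in> I \<Longrightarrow> d \<noteq> 0 \<Longrightarrow> degree g \<le> degree d"
    using ex_has_least_nat[of "\<lambda>d. d \<in> I \<and> d \<noteq> 0" _ degree] by blast
  \<comment> \<open>division with remainder: a nonzero element of least degree generates the ideal\<close>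
  have "g dvd d" if d: "d \<in> I" for d
  proof -
    have "d mod g \<in> I" using comb[OF d g(1), of "d div g"] by (simp add: minus_div_mult_eq_mod)
    then have "d mod g = 0" using min[of "d mod g"] degree_mod_less[OF g(2), of d] by force
    then show ?thesis by (simp add: dvd_eq_mod_eq_0)
  qed
  then have root: "poly g l \<noteq> 0" if "l \<in> \<Omega>" for l
    using local[OF that] by (metis dvdE poly_mult mult_zero_left)
  obtain X where X: "X \<in> defined_mats \<Omega> c r" "T * X = to_fract g \<cdot>\<^sub>m 1\<^sub>m r"
    using g(1) unfolding I_def by blast
  let ?Z = "Fract 1 g \<cdot>\<^sub>m X"
  have Z: "?Z \<in> defined_mats \<Omega> c r"
    using root by (intro defined_mats_smult X ratfun_Fract)
  have "T * ?Z = Fract 1 g \<cdot>\<^sub>m (T * X)"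
    using X(1)[THEN defined_matsD(1)] T[THEN defined_matsD(1)]
    by (intro mult_smult_distrib) auto
  also have "Fract 1 g * to_fract g = 1" using g(2) by (simp add: to_fract_def One_fract_def eq_fract)
  then have "Fract 1 g \<cdot>\<^sub>m (T * X) = 1\<^sub>m r"
    unfolding X(2) by (intro eq_matI) (auto simp: mult.assoc[symmetric])
  finally show ?thesis using that Z by blast
qed

lemma full_row_rank_in_imp_right_inverse:
  assumes T: "T \<in> carrier_mat r c" and rk: "full_row_rank_in \<Omega> T" and ne: "\<Omega> \<noteq> {}"
  obtains X where "X \<in> defined_mats \<Omega> c r" "T * X = 1\<^sub>m r"
proof (rule pointwise_imp_global_right_inverse)
  show "T \<in> defined_mats \<Omega> r c" using T rk unfolding full_row_rank_in_def defined_mats_def by simp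
  fix l assume "l \<in> \<Omega>"
  then have "mat_rank (ratmat_eval T l) = r" using rk T by (simp add: full_row_rank_in_def)
  then show "\<exists>Y \<in> carrier_mat c r. ratmat_eval T l * Y = 1\<^sub>m r"
    using full_row_rank_imp_right_inverse[OF ratmat_eval_carrier[OF T]] by metis
qed (use ne that in auto)

lemma pointwise_imp_global_left_inverse:
  fixes \<Omega> :: "'a::field set"
  assumes T: "T \<in> defined_mats \<Omega> r c" and ne: "\<Omega> \<noteq> {}"
    and inv: "\<And>l. l \<in> \<Omega> \<Longrightarrow> \<exists>Y \<in> carrier_mat c r. Y * ratmat_eval T l = 1\<^sub>m c"
  obtains X where "X \<in> defined_mats \<Omega> c r" "X * T = 1\<^sub>m c"
proof (rule pointwise_imp_global_right_inverse)
  show "transpose_mat T \<in> defined_mats \<Omega> c r" using T by (rule defined_mats_transpose)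
  note c = T[THEN defined_matsD(1)]
  fix l assume "l \<in> \<Omega>"
  then obtain Y where Y: "Y \<in> carrier_mat c r" "Y * ratmat_eval T l = 1\<^sub>m c" using inv by blast
  have "ratmat_eval (transpose_mat T) l = transpose_mat (ratmat_eval T l)"
    by (rule eq_matI) (auto simp: ratmat_eval_def)
  moreover have "transpose_mat (ratmat_eval T l) * transpose_mat Y = 1\<^sub>m c"
    using transpose_mult[OF Y(1) ratmat_eval_carrier[OF c, of l]] Y(2) by simp
  ultimately show "\<exists>Y \<in> carrier_mat r c. ratmat_eval (transpose_mat T) l * Y = 1\<^sub>m c"
    using Y(1) by auto
next
  fix X assume X: "X \<in> defined_mats \<Omega> r c" "transpose_mat T * X = 1\<^sub>m c"
  have "transpose_mat X * T = 1\<^sub>m c"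
    using transpose_mult[OF _ X(1)[THEN defined_matsD(1)], of "transpose_mat T" c]
      T[THEN defined_matsD(1)] X(2) by simp
  then show thesis using that[of "transpose_mat X"] defined_mats_transpose[OF X(1)] by blast
qed (use ne in auto)

section \<open>Arithmetic of block matrices\<close>

text \<open>The side conditions below are equations between dimensions without further variables, so that the
simplifier can discharge them and the identities can be used as rewrite rules.\<close>

lemma assoc_mult_mat_dim:
  "dim_col X = dim_row Y \<Longrightarrow> dim_col Y = dim_row Z \<Longrightarrow> X * Y * Z = X * (Y * (Z :: 'a::comm_ring_1 mat))"
  by (rule assoc_mult_mat) auto

lemma distrib_mat_dim:
  fixes X Y Z :: "'a::comm_ring_1 mat"
  shows "dim_row X = dim_row Y \<Longrightarrow> dim_col X = dim_col Y \<Longrightarrow> dim_col Y = dim_row Z \<Longrightarrow>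
      (X + Y) * Z = X * Z + Y * Z"
    and "dim_row X = dim_row Y \<Longrightarrow> dim_col X = dim_col Y \<Longrightarrow> dim_col Y = dim_row Z \<Longrightarrow>
      (X - Y) * Z = X * Z - Y * Z"
    and "dim_row Y = dim_row Z \<Longrightarrow> dim_col Y = dim_col Z \<Longrightarrow> dim_col X = dim_row Y \<Longrightarrow>
      X * (Y + Z) = X * Y + X * Z"
    and "dim_row Y = dim_row Z \<Longrightarrow> dim_col Y = dim_col Z \<Longrightarrow> dim_col X = dim_row Y \<Longrightarrow>
      X * (Y - Z) = X * Y - X * Z"
  by (rule add_mult_distrib_mat minus_mult_distrib_mat mult_add_distrib_mat
      mult_minus_distrib_mat; auto)+

lemma mult_one_zero_mat_dim:
  fixes X :: "'a::comm_ring_1 mat"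
  shows "dim_row X = r \<Longrightarrow> 1\<^sub>m r * X = X" "dim_col X = r \<Longrightarrow> X * 1\<^sub>m r = X"
    "dim_row X = r \<Longrightarrow> 0\<^sub>m s r * X = 0\<^sub>m s (dim_col X)"
    "dim_col X = r \<Longrightarrow> X * 0\<^sub>m r s = 0\<^sub>m (dim_row X) s"
    "dim_col X = dim_row Y \<Longrightarrow> (- X) * Y = - (X * Y)"
    "dim_col X = dim_row Y \<Longrightarrow> X * (- Y) = - (X * Y)"
  by (auto intro!: eq_matI simp: scalar_prod_def sum_negf)

lemma minus_add_mat_dim:
  fixes X Y Z :: "'a::comm_ring_1 mat"
  assumes "dim_row X = dim_row Y" "dim_col X = dim_col Y" "dim_row Y = dim_row Z" "dim_col Y = dim_col Z"
  shows "X - (Y + Z) = X - Y - Z"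
  using assms by (intro eq_matI) auto

lemma add_minus_cancel_mat_dim:
  fixes X Y :: "'a::comm_ring_1 mat"
  assumes "dim_row X = dim_row Y" "dim_col X = dim_col Y"
  shows "X + Y - Y = X"
  using assms by (intro eq_matI) auto

lemmas mat_ring_dim = assoc_mult_mat_dim distrib_mat_dim mult_one_zero_mat_dim

lemma transpose_mult_dim:
  "dim_col X = dim_row Y \<Longrightarrow> transpose_mat (X * Y) = transpose_mat Y * transpose_mat (X :: 'a::comm_ring_1 mat)"
  by (rule transpose_mult) auto

lemma transpose_add_dim:
  "dim_row X = dim_row Y \<Longrightarrow> dim_col X = dim_col Y \<Longrightarrow>
    transpose_mat (X + Y) = transpose_mat X + transpose_mat (Y :: 'a::comm_ring_1 mat)"
  by (rule transpose_add) auto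

lemma carrier_mat_iff: "X \<in> carrier_mat r c \<longleftrightarrow> dim_row X = r \<and> dim_col X = c"
  by auto

lemma append_cols_carrier:
  "X \<in> carrier_mat r c1 \<Longrightarrow> Y \<in> carrier_mat r c2 \<Longrightarrow> X @\<^sub>c Y \<in> carrier_mat r (c1 + c2)"
  unfolding append_cols_def carrier_mat_iff by simp

lemma append_dims [simp]:
  "dim_row (X @\<^sub>c Y) = dim_row X" "dim_col (X @\<^sub>c Y) = dim_col X + dim_col Y"
  "dim_row (X @\<^sub>r Y) = dim_row X + dim_row Y" "dim_col (X @\<^sub>r Y) = dim_col X"
  by (simp_all add: append_cols_def append_rows_def)

lemma append_cols_mult_append_rows:
  fixes X Y Z W :: "'a::comm_ring_1 mat"
  assumes c: "X \<in> carrier_mat r n1" "Y \<in> carrier_mat r n2" "Z \<in> carrier_mat n1 c" "W \<in> carrier_mat n2 c"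
  shows "(X @\<^sub>c Y) * (Z @\<^sub>r W) = X * Z + Y * W"
proof -
  have "(X @\<^sub>c Y) * (Z @\<^sub>r W) = four_block_mat (X * Z + Y * W) (X * 0\<^sub>m n1 0 + Y * 0\<^sub>m n2 0)
      (0\<^sub>m 0 n1 * Z + 0\<^sub>m 0 n2 * W) (0\<^sub>m 0 n1 * 0\<^sub>m n1 0 + 0\<^sub>m 0 n2 * 0\<^sub>m n2 0)"
    unfolding append_cols_def append_rows_def using c
    by (subst mult_four_block_mat[of _ r n1 _ n2 _ 0 _ _ c _ 0]) auto
  also have "\<dots> = X * Z + Y * W" using c by (intro eq_matI) auto
  finally show ?thesis .
qed

lemma append_rows_mult_append_cols:
  fixes X Y Z W :: "'a::comm_ring_1 mat"
  assumes c: "Z \<in> carrier_mat r1 n" "W \<in> carrier_mat r2 n" "X \<in> carrier_mat n c1" "Y \<in> carrier_mat n c2"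
  shows "(Z @\<^sub>r W) * (X @\<^sub>c Y) = four_block_mat (Z * X) (Z * Y) (W * X) (W * Y)"
proof -
  have z: "0\<^sub>m r 0 * 0\<^sub>m 0 s = (0\<^sub>m r s :: 'a mat)" for r s by (intro eq_matI) auto
  show ?thesis
    unfolding append_cols_def append_rows_def using c
    by (subst mult_four_block_mat[of _ r1 n _ 0 _ r2 _ _ c1 _ c2]) (auto simp: z)
qed

lemma mult_append_cols:
  fixes X Y Z :: "'a::comm_ring_1 mat"
  assumes X: "X \<in> carrier_mat r n" and Y: "Y \<in> carrier_mat n c1" and Z: "Z \<in> carrier_mat n c2"
  shows "X * (Y @\<^sub>c Z) = X * Y @\<^sub>c X * Z"
proof (rule mat_col_eqI)
  fix j assume "j < dim_col (X * Y @\<^sub>c X * Z)"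
  then have j: "j < c1 + c2" using Y Z by simp
  have YZ: "Y @\<^sub>c Z \<in> carrier_mat n (c1 + c2)" using append_cols_carrier[OF Y Z] .
  have "col (Y @\<^sub>c Z) j = (if j < c1 then col Y j else col Z (j - c1))"
    using j Y Z by (intro eq_vecI) (auto simp: append_cols_def)
  moreover have "col (X * Y @\<^sub>c X * Z) j = (if j < c1 then col (X * Y) j else col (X * Z) (j - c1))"
    using j X Y Z by (intro eq_vecI) (auto simp: append_cols_def)
  ultimately show "col (X * (Y @\<^sub>c Z)) j = col (X * Y @\<^sub>c X * Z) j"
    using col_mult2[OF X YZ j] col_mult2[OF X Y, of j] col_mult2[OF X Z, of "j - c1"] j by auto
qed (use X Y Z in auto)

lemma map_mat_append_rows:
  "dim_col X = dim_col Y \<Longrightarrow> map_mat f (X @\<^sub>r Y) = map_mat f X @\<^sub>r map_mat f Y"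
  by (rule eq_matI) (auto simp: append_rows_def)

lemma map_mat_append_cols:
  "dim_row X = dim_row Y \<Longrightarrow> map_mat f (X @\<^sub>c Y) = map_mat f X @\<^sub>c map_mat f Y"
  by (rule eq_matI) (auto simp: append_cols_def)

section \<open>Bezout identities and minimality\<close>

text \<open>The stacked matrix of \<open>A\<close> and \<open>- N C\<close> has a left inverse at each point of \<open>\<Omega>\<close>, hence a left inverse
without poles in \<open>\<Omega>\<close>, whose two blocks are \<open>E\<close> and \<open>- F\<close>.\<close>

lemma bezout_of_column_rank:
  fixes A C :: "'a::field poly mat"
  assumes A: "A \<in> carrier_mat n n" and C: "C \<in> carrier_mat a n" and N: "N \<in> defined_mats \<Omega> p a"
    and ne: "\<Omega> \<noteq> {}"
    and rank: "\<And>l. l \<in> \<Omega> \<Longrightarrow>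
      mat_rank (polymat_eval A l @\<^sub>r (- (ratmat_eval N l * polymat_eval C l))) = n"
  obtains E F where "E \<in> defined_mats \<Omega> n n" "F \<in> defined_mats \<Omega> n p"
    "E * rat_of_polymat A + F * (N * rat_of_polymat C) = 1\<^sub>m n"
proof -
  note rA = defined_mats_polymat[OF A, of \<Omega>] and rC = defined_mats_polymat[OF C, of \<Omega>]
  let ?G = "N * rat_of_polymat C" and ?T = "rat_of_polymat A @\<^sub>r - (N * rat_of_polymat C)"
  have G: "?G \<in> defined_mats \<Omega> p n" by (rule defined_mats_mult(1)[OF N rC])
  have T: "?T \<in> defined_mats \<Omega> (n + p) n"
    by (rule defined_mats_append_rows[OF rA defined_mats_uminus[OF G]])
  have eval: "ratmat_eval ?T l = polymat_eval A l @\<^sub>r (- (ratmat_eval N l * polymat_eval C l))"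
    if "l \<in> \<Omega>" for l
  proof -
    have "ratmat_eval ?T l = ratmat_eval (rat_of_polymat A) l @\<^sub>r ratmat_eval (- ?G) l"
      using defined_matsD(1)[OF rA] defined_matsD(1)[OF G] unfolding ratmat_eval_def
      by (intro map_mat_append_rows) auto
    then show ?thesis using ratmat_eval_uminus[OF G that] defined_mats_mult(2)[OF N rC that] by simp
  qed
  obtain X where X: "X \<in> defined_mats \<Omega> n (n + p)" "X * ?T = 1\<^sub>m n"
  proof (rule pointwise_imp_global_left_inverse[OF T ne])
    fix l assume l: "l \<in> \<Omega>"
    then have "mat_rank (ratmat_eval ?T l) = n" using rank eval by simp
    then show "\<exists>Y \<in> carrier_mat n (n + p). Y * ratmat_eval ?T l = 1\<^sub>m n"
      using full_column_rank_imp_left_inverse[OF ratmat_eval_carrier[OF defined_matsD(1)[OF T]]] by metis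
  qed
  obtain E F where EF: "E \<in> defined_mats \<Omega> n n" "F \<in> defined_mats \<Omega> n p" "X = E @\<^sub>c F"
    using defined_mats_split_cols[OF X(1)] .
  have "1\<^sub>m n = E * rat_of_polymat A + F * - ?G"
    using X(2) append_cols_mult_append_rows[OF EF(1,2)[THEN defined_matsD(1)] defined_matsD(1)[OF rA]
      defined_matsD(1)[OF defined_mats_uminus[OF G]]] EF(3) by simp
  also have "F * - ?G = - F * ?G"
    using EF(2)[THEN defined_matsD(1)] defined_matsD(1)[OF G]
    by (metis carrier_matD mult_one_zero_mat_dim(5,6))
  finally show ?thesis using that[OF EF(1) defined_mats_uminus[OF EF(2)]] by simp
qed

lemma bezout_of_row_rank:
  fixes A B :: "'a::field poly mat"
  assumes A: "A \<in> carrier_mat n n" and B: "B \<in> carrier_mat n b" and N: "N \<in> defined_mats \<Omega> m b"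
    and ne: "\<Omega> \<noteq> {}"
    and rank: "\<And>l. l \<in> \<Omega> \<Longrightarrow>
      mat_rank (polymat_eval A l @\<^sub>c (polymat_eval B l * transpose_mat (ratmat_eval N l))) = n"
  obtains E F where "E \<in> defined_mats \<Omega> n n" "F \<in> defined_mats \<Omega> m n"
    "rat_of_polymat A * E + rat_of_polymat B * transpose_mat N * F = 1\<^sub>m n"
proof -
  note rA = defined_mats_polymat[OF A, of \<Omega>] and rB = defined_mats_polymat[OF B, of \<Omega>]
  note Nt = defined_mats_transpose[OF N]
  let ?G = "rat_of_polymat B * transpose_mat N"
  let ?T = "rat_of_polymat A @\<^sub>c ?G"
  have G: "?G \<in> defined_mats \<Omega> n m" by (rule defined_mats_mult(1)[OF rB Nt])
  have T: "?T \<in> defined_mats \<Omega> n (n + m)" by (rule defined_mats_append_cols[OF rA G])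
  have eval: "ratmat_eval ?T l = polymat_eval A l @\<^sub>c (polymat_eval B l * transpose_mat (ratmat_eval N l))"
    if "l \<in> \<Omega>" for l
  proof -
    have "ratmat_eval ?T l = ratmat_eval (rat_of_polymat A) l @\<^sub>c ratmat_eval ?G l"
      using defined_matsD(1)[OF rA] defined_matsD(1)[OF G] unfolding ratmat_eval_def
      by (intro map_mat_append_cols) auto
    then show ?thesis using defined_mats_mult(2)[OF rB Nt that] by (simp add: ratmat_eval_transpose)
  qed
  obtain X where X: "X \<in> defined_mats \<Omega> (n + m) n" "?T * X = 1\<^sub>m n"
  proof (rule pointwise_imp_global_right_inverse[OF T ne])
    fix l assume l: "l \<in> \<Omega>"
    then have "mat_rank (ratmat_eval ?T l) = n" using rank eval by simp
    then show "\<exists>Y \<in> carrier_mat (n + m) n. ratmat_eval ?T l * Y = 1\<^sub>m n"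
      using full_row_rank_imp_right_inverse[OF ratmat_eval_carrier[OF defined_matsD(1)[OF T]]] by metis
  qed
  obtain E F where EF: "E \<in> defined_mats \<Omega> n n" "F \<in> defined_mats \<Omega> m n" "X = E @\<^sub>r F"
    using defined_mats_split_rows[OF X(1)] .
  have "rat_of_polymat A * E + ?G * F = 1\<^sub>m n"
    using X(2) append_cols_mult_append_rows[OF defined_matsD(1)[OF rA] defined_matsD(1)[OF G]
      EF(1,2)[THEN defined_matsD(1)]] EF(3) by simp
  then show ?thesis using that[OF EF(1,2)] by simp
qed

text \<open>The Bezout identities survive evaluation at the points of \<open>\<Omega>\<close> and exhibit a left and a right
inverse there.\<close>

lemma minimal_inI:
  fixes A :: "'a::field poly mat"
  assumes A: "A \<in> carrier_mat n n" and B: "B \<in> carrier_mat n r" and C: "C \<in> carrier_mat q n"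
    and E: "E \<in> defined_mats \<Omega> n n" and F: "F \<in> defined_mats \<Omega> n q"
    and EF: "E * rat_of_polymat A + F * rat_of_polymat C = 1\<^sub>m n"
    and E': "E' \<in> defined_mats \<Omega> n n" and F': "F' \<in> defined_mats \<Omega> r n"
    and EF': "rat_of_polymat A * E' + rat_of_polymat B * F' = 1\<^sub>m n"
  shows "minimal_in \<Omega> A B C"
  unfolding minimal_in_def
proof (intro ballI conjI)
  fix l assume l: "l \<in> \<Omega>"
  note rA = defined_mats_polymat[OF A, of \<Omega>] and rB = defined_mats_polymat[OF B, of \<Omega>]
    and rC = defined_mats_polymat[OF C, of \<Omega>]
  let ?R = "rat_of_polymat A @\<^sub>r rat_of_polymat C" and ?S = "rat_of_polymat A @\<^sub>c rat_of_polymat B"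
  have R: "?R \<in> defined_mats \<Omega> (n + q) n" by (rule defined_mats_append_rows[OF rA rC])
  have S: "?S \<in> defined_mats \<Omega> n (n + r)" by (rule defined_mats_append_cols[OF rA rB])
  have X: "E @\<^sub>c F \<in> defined_mats \<Omega> n (n + q)" by (rule defined_mats_append_cols[OF E F])
  have Y: "E' @\<^sub>r F' \<in> defined_mats \<Omega> (n + r) n" by (rule defined_mats_append_rows[OF E' F'])
  have eR: "ratmat_eval ?R l = polymat_eval A l @\<^sub>r polymat_eval C l"
    using A C by (subst (1 2) ratmat_eval_polymat[symmetric], unfold ratmat_eval_def)
      (intro map_mat_append_rows, simp add: rat_of_polymat_def)
  have eS: "ratmat_eval ?S l = polymat_eval A l @\<^sub>c polymat_eval B l"
    using A B by (subst (1 2) ratmat_eval_polymat[symmetric], unfold ratmat_eval_def)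
      (intro map_mat_append_cols, simp add: rat_of_polymat_def)
  have "(E @\<^sub>c F) * ?R = 1\<^sub>m n"
    using append_cols_mult_append_rows[of E n n F q "rat_of_polymat A" n "rat_of_polymat C"]
      defined_matsD(1)[OF E] defined_matsD(1)[OF F] defined_matsD(1)[OF rA] defined_matsD(1)[OF rC] EF
    by simp
  then have "ratmat_eval (E @\<^sub>c F) l * ratmat_eval ?R l = 1\<^sub>m n"
    using defined_mats_mult(2)[OF X R l] by simp
  then have "mat_rank (ratmat_eval ?R l) = n"
    by (rule left_inverse_imp_full_column_rank[OF ratmat_eval_carrier[OF defined_matsD(1)[OF R]]
        ratmat_eval_carrier[OF defined_matsD(1)[OF X]]])
  then show "mat_rank (polymat_eval A l @\<^sub>r polymat_eval C l) = dim_row A" using eR A by simp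
  have "?S * (E' @\<^sub>r F') = 1\<^sub>m n"
    using append_cols_mult_append_rows[of "rat_of_polymat A" n n "rat_of_polymat B" r E' n F']
      defined_matsD(1)[OF E'] defined_matsD(1)[OF F'] defined_matsD(1)[OF rA] defined_matsD(1)[OF rB] EF'
    by simp
  then have "ratmat_eval ?S l * ratmat_eval (E' @\<^sub>r F') l = 1\<^sub>m n"
    using defined_mats_mult(2)[OF S Y l] by simp
  then have "mat_rank (ratmat_eval ?S l) = n"
    by (rule right_inverse_imp_full_row_rank[OF ratmat_eval_carrier[OF defined_matsD(1)[OF S]]
        ratmat_eval_carrier[OF defined_matsD(1)[OF Y]]])
  then show "mat_rank (polymat_eval A l @\<^sub>c polymat_eval B l) = dim_row A" using eS A by simp
qed

section \<open>Elimination in the presence of poles\<close>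

text \<open>\<open>[N; \<nu>]\<close> and \<open>[\<alpha>, K\<^sup>T]\<close> are inverse to each other. The right inverse \<open>\<alpha>\<close> of \<open>N\<close> can be changed by any
multiple of \<open>W = I - N' N\<close>, because \<open>N W = 0\<close>; the choice \<open>\<alpha> = N' + W C F\<close> is the one with
\<open>I - \<alpha> N = W (I - C F N)\<close>, and \<open>(I - C F N) C = C (I - F N C) = C E A\<close> is divisible by \<open>A\<close> on the right.
This is what cancels the poles of \<open>A\<inverse>\<close>.\<close>

lemma complement_regularizing_pole:
  fixes N K :: "'a::field poly fract mat"
  assumes N: "N \<in> defined_mats \<Omega> p a" and K: "K \<in> defined_mats \<Omega> k a"
    and pk: "p + k = a" and NK: "N * transpose_mat K = 0\<^sub>m p k"
    and N': "N' \<in> defined_mats \<Omega> a p" "N * N' = 1\<^sub>m p"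
    and K': "K' \<in> defined_mats \<Omega> a k" "K * K' = 1\<^sub>m k"
    and C: "C \<in> defined_mats \<Omega> a n"
    and A: "A \<in> carrier_mat n n" and Ai: "Ai \<in> carrier_mat n n" "A * Ai = 1\<^sub>m n"
    and E: "E \<in> defined_mats \<Omega> n n" and F: "F \<in> defined_mats \<Omega> n p"
    and bez: "E * A + F * (N * C) = 1\<^sub>m n"
  obtains \<alpha> \<nu> where "\<alpha> \<in> defined_mats \<Omega> a p" "\<nu> \<in> defined_mats \<Omega> k a"
    "\<alpha> * N + transpose_mat K * \<nu> = 1\<^sub>m a" "\<nu> * C * Ai \<in> defined_mats \<Omega> k n"
proof -
  define W where "W = 1\<^sub>m a - N' * N"
  define \<alpha> where "\<alpha> = N' + W * (C * F)"
  define \<nu> where "\<nu> = transpose_mat K' * (1\<^sub>m a - \<alpha> * N)"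
  let ?Kt = "transpose_mat K" and ?Kt' = "transpose_mat K'"
  have W: "W \<in> defined_mats \<Omega> a a" unfolding W_def
    by (intro defined_mats_minus defined_mats_one_zero defined_mats_mult(1)[OF N'(1) N])
  have \<alpha>: "\<alpha> \<in> defined_mats \<Omega> a p" unfolding \<alpha>_def
    by (intro defined_mats_add N'(1) defined_mats_mult(1)[OF W] defined_mats_mult(1)[OF C F])
  have \<nu>: "\<nu> \<in> defined_mats \<Omega> k a" unfolding \<nu>_def
    by (intro defined_mats_mult(1)[OF defined_mats_transpose[OF K'(1)]] defined_mats_minus
        defined_mats_one_zero defined_mats_mult(1)[OF \<alpha> N])
  have Kt: "?Kt \<in> carrier_mat a k" using K defined_matsD(1) by auto
  have dims [simp]: "dim_row N = p" "dim_col N = a" "dim_row K = k" "dim_col K = a"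
    "dim_row N' = a" "dim_col N' = p" "dim_row K' = a" "dim_col K' = k"
    "dim_row C = a" "dim_col C = n" "dim_row A = n" "dim_col A = n" "dim_row Ai = n" "dim_col Ai = n"
    "dim_row E = n" "dim_col E = n" "dim_row F = n" "dim_col F = p"
    "dim_row W = a" "dim_col W = a" "dim_row \<alpha> = a" "dim_col \<alpha> = p" "dim_row \<nu> = k" "dim_col \<nu> = a"
    using N K N' K' C A Ai E F W \<alpha> \<nu> by (auto simp: defined_mats_def)
  have NN': "N * (N' * X) = X" if "dim_row X = p" for X
    using that N'(2) by (simp add: mat_ring_dim flip: assoc_mult_mat_dim)
  have NW: "N * W = 0\<^sub>m p a" unfolding W_def
    by (simp add: mat_ring_dim NN') (intro eq_matI, auto)
  have "N * (W * X) = 0\<^sub>m p (dim_col X)" if "dim_row X = a" for X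
    using that NW by (simp add: mat_ring_dim flip: assoc_mult_mat_dim)
  then have N\<alpha>: "N * \<alpha> = 1\<^sub>m p" unfolding \<alpha>_def
    using N'(2) by (simp add: mat_ring_dim)
  have KK': "?Kt' * ?Kt = 1\<^sub>m k"
    using transpose_mult[of K k a K' k] K'(2) K'(1) K by (simp add: defined_mats_def)
  have "\<nu> * ?Kt = 1\<^sub>m k" unfolding \<nu>_def
    by (simp add: mat_ring_dim NK KK') (intro eq_matI, auto)
  moreover have "\<nu> * \<alpha> = 0\<^sub>m k p" unfolding \<nu>_def
    by (simp add: mat_ring_dim N\<alpha>) (intro eq_matI, auto)
  ultimately have inv: "(N @\<^sub>r \<nu>) * (\<alpha> @\<^sub>c ?Kt) = 1\<^sub>m a"
    using append_rows_mult_append_cols[OF N[THEN defined_matsD(1)] \<nu>[THEN defined_matsD(1)]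
      \<alpha>[THEN defined_matsD(1)] Kt] N\<alpha> NK pk by simp
  have "N @\<^sub>r \<nu> \<in> carrier_mat a a" "\<alpha> @\<^sub>c ?Kt \<in> carrier_mat a a"
    using carrier_append_rows[OF N[THEN defined_matsD(1)] \<nu>[THEN defined_matsD(1)]]
      append_cols_carrier[OF \<alpha>[THEN defined_matsD(1)] Kt] pk by simp_all
  \<comment> \<open>both factors are square because \<open>p + k = a\<close>, so the factors may be exchanged\<close>
  from mat_mult_left_right_inverse[OF this inv]
  have "(\<alpha> @\<^sub>c ?Kt) * (N @\<^sub>r \<nu>) = 1\<^sub>m a" .
  then have id: "\<alpha> * N + ?Kt * \<nu> = 1\<^sub>m a"
    using append_cols_mult_append_rows[OF \<alpha>[THEN defined_matsD(1)] Kt N[THEN defined_matsD(1)]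
      \<nu>[THEN defined_matsD(1)]] by simp
  have "\<alpha> * N = N' * N + W * (C * (F * N))"
    unfolding \<alpha>_def by (simp add: mat_ring_dim)
  then have "1\<^sub>m a - \<alpha> * N = W - W * (C * (F * N))"
    by (simp add: minus_add_mat_dim W_def)
  then have "(1\<^sub>m a - \<alpha> * N) * C = W * C * (1\<^sub>m n - F * (N * C))"
    by (simp add: mat_ring_dim)
  also have "1\<^sub>m n - F * (N * C) = E * A"
    unfolding bez[symmetric] by (simp add: add_minus_cancel_mat_dim)
  finally have "(1\<^sub>m a - \<alpha> * N) * C = W * C * (E * A)" .
  then have "\<nu> * C * Ai = ?Kt' * (W * C * (E * A)) * Ai"
    unfolding \<nu>_def by (simp add: assoc_mult_mat_dim)
  also have "\<dots> = ?Kt' * (W * (C * E))" by (simp add: mat_ring_dim Ai(2))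
  finally have "\<nu> * C * Ai \<in> defined_mats \<Omega> k n"
    using defined_mats_mult(1)[OF defined_mats_transpose[OF K'(1)]
      defined_mats_mult(1)[OF W defined_mats_mult(1)[OF C E]]] by simp
  then show ?thesis using that[OF \<alpha> \<nu> id] by blast
qed

text \<open>Splitting \<open>Q = (\<alpha> N2 + K2\<^sup>T \<nu>) Q (N1\<^sup>T \<gamma> + \<kappa> K1)\<close> gives
\<open>Q = \<alpha> R \<gamma> + K2\<^sup>T \<delta> + \<beta> K1\<close> with \<open>R = N2 Q N1\<^sup>T\<close>, \<open>\<delta> = \<nu> Q\<close> and \<open>\<beta> = \<alpha> N2 Q \<kappa>\<close>. So the poles of \<open>Q\<close>
in \<open>\<Omega>\<close> are those of \<open>R\<close>, and the borders \<open>K2\<^sup>T\<close> and \<open>K1\<close> produce the other two summands. The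
equivalence is
\<open>R1 = [\<alpha>, K2\<^sup>T, \<beta>; 0, 0, I]\<close> and \<open>R2 = [\<gamma>, 0; \<delta>, I; K1, 0]\<close>.\<close>

lemma schur_block_equivalence:
  fixes Q :: "'a::field poly fract mat"
  assumes Q: "Q \<in> carrier_mat a b"
    and N1: "N1 \<in> defined_mats \<Omega> m b" and K1: "K1 \<in> defined_mats \<Omega> k1 b"
    and N2: "N2 \<in> defined_mats \<Omega> p a" and K2: "K2 \<in> defined_mats \<Omega> k2 a"
    and sizes: "p + k2 = a" "m + k1 = b"
    and \<alpha>: "\<alpha> \<in> defined_mats \<Omega> a p" and \<nu>: "\<nu> \<in> defined_mats \<Omega> k2 a"
    and \<gamma>: "\<gamma> \<in> defined_mats \<Omega> m b" and \<kappa>: "\<kappa> \<in> defined_mats \<Omega> b k1"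
    and idL: "\<alpha> * N2 + transpose_mat K2 * \<nu> = 1\<^sub>m a"
    and idR: "transpose_mat N1 * \<gamma> + \<kappa> * K1 = 1\<^sub>m b"
    and \<nu>Q: "\<nu> * Q \<in> defined_mats \<Omega> k2 b" and Q\<kappa>: "Q * \<kappa> \<in> defined_mats \<Omega> a k1"
  obtains R1 R2 where
    "R1 \<in> carrier_mat (p + (k2 + k1)) (p + (k2 + k1))" "ratmat_invertible_in \<Omega> R1"
    "R2 \<in> carrier_mat (m + (k2 + k1)) (m + (k2 + k1))" "ratmat_invertible_in \<Omega> R2"
    "R1 * four_block_mat (N2 * Q * transpose_mat N1) (0\<^sub>m p (k2 + k1)) (0\<^sub>m (k2 + k1) m) (1\<^sub>m (k2 + k1)) * R2
      = four_block_mat Q (transpose_mat K2) K1 (0\<^sub>m k1 k2)"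
proof -
  let ?K2t = "transpose_mat K2" and ?N1t = "transpose_mat N1" and ?s = "k2 + k1"
  define \<beta> where "\<beta> = \<alpha> * (N2 * (Q * \<kappa>))"
  define \<delta> where "\<delta> = \<nu> * Q"
  have \<beta>: "\<beta> \<in> defined_mats \<Omega> a k1" unfolding \<beta>_def
    by (rule defined_mats_mult(1)[OF \<alpha> defined_mats_mult(1)[OF N2 Q\<kappa>]])
  have \<delta>: "\<delta> \<in> defined_mats \<Omega> k2 b" unfolding \<delta>_def by (rule \<nu>Q)
  have K2t: "?K2t \<in> defined_mats \<Omega> a k2" by (rule defined_mats_transpose[OF K2])
  have N1t: "?N1t \<in> defined_mats \<Omega> b m" by (rule defined_mats_transpose[OF N1])
  note products = defined_mats_mult(1)[OF N2 \<beta>] defined_mats_mult(1)[OF \<nu> \<beta>]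
    defined_mats_mult(1)[OF \<delta> N1t] defined_mats_mult(1)[OF \<delta> \<kappa>]
  note cs = N1 K1 N2 K2 \<alpha> \<nu> \<gamma> \<kappa> \<beta> \<delta> K2t N1t
  note c = cs[THEN defined_matsD(1)]
  have dims [simp]: "dim_row Q = a" "dim_col Q = b" "dim_row N1 = m" "dim_col N1 = b"
    "dim_row K1 = k1" "dim_col K1 = b" "dim_row N2 = p" "dim_col N2 = a" "dim_row K2 = k2" "dim_col K2 = a"
    "dim_row \<alpha> = a" "dim_col \<alpha> = p" "dim_row \<nu> = k2" "dim_col \<nu> = a"
    "dim_row \<gamma> = m" "dim_col \<gamma> = b" "dim_row \<kappa> = b" "dim_col \<kappa> = k1"
    "dim_row \<beta> = a" "dim_col \<beta> = k1" "dim_row \<delta> = k2" "dim_col \<delta> = b"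
    using c Q by auto
  have zero [simp]: "X + 0\<^sub>m r q = X" "0\<^sub>m r q + X = X"
    if "dim_row X = r" "dim_col X = q" for X :: "'a poly fract mat" and r q
    using that by (auto intro!: eq_matI)
  have neg_zero [simp]: "- 0\<^sub>m r q = (0\<^sub>m r q :: 'a poly fract mat)" for r q
    by (intro eq_matI) auto
  have cancel: "- X + (- Y + Z) = 0\<^sub>m r q" "- X + (Z + - Y) = 0\<^sub>m r q"
    if "X + Y = Z" "dim_row X = r" "dim_col X = q" "dim_row Y = r" "dim_col Y = q"
    for X Y Z :: "'a poly fract mat" and r q
    using that by (auto intro!: eq_matI)
  have add_rotate: "X + Y + Z = X + (Z + Y)"
    if "dim_row X = dim_row Y" "dim_col X = dim_col Y" "dim_row Y = dim_row Z" "dim_col Y = dim_col Z"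
    for X Y Z :: "'a poly fract mat"
    using that by (auto intro!: eq_matI)
  \<comment> \<open>\<open>R1'\<close> and \<open>R2'\<close> are the inverses, found by back substitution from
    \<open>[\<alpha>, K2\<^sup>T]\<inverse> = [N2; \<nu>]\<close> and \<open>[\<gamma>; K1]\<inverse> = [N1\<^sup>T, \<kappa>]\<close>\<close>
  define R1 where "R1 = four_block_mat \<alpha> (?K2t @\<^sub>c \<beta>) (0\<^sub>m k1 p) (0\<^sub>m k1 k2 @\<^sub>c 1\<^sub>m k1)"
  define R1' where "R1' = four_block_mat N2 (- (N2 * \<beta>)) (\<nu> @\<^sub>r 0\<^sub>m k1 a) (- (\<nu> * \<beta>) @\<^sub>r 1\<^sub>m k1)"
  define R2 where "R2 = four_block_mat \<gamma> (0\<^sub>m m k2) (\<delta> @\<^sub>r K1) (1\<^sub>m k2 @\<^sub>r 0\<^sub>m k1 k2)"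
  define R2' where "R2' = four_block_mat ?N1t (0\<^sub>m b k2 @\<^sub>c \<kappa>) (- (\<delta> * ?N1t)) (1\<^sub>m k2 @\<^sub>c - (\<delta> * \<kappa>))"
  have dR: "R1 \<in> defined_mats \<Omega> (a + k1) (p + ?s)" "R1' \<in> defined_mats \<Omega> (p + ?s) (a + k1)"
    "R2 \<in> defined_mats \<Omega> (m + ?s) (b + k2)" "R2' \<in> defined_mats \<Omega> (b + k2) (m + ?s)"
    unfolding R1_def R1'_def R2_def R2'_def
    by (rule defined_mats_four_block[OF \<alpha> defined_mats_append_cols[OF K2t \<beta>] defined_mats_one_zero(2)
          defined_mats_append_cols[OF defined_mats_one_zero(2) defined_mats_one_zero(1)]]
        defined_mats_four_block[OF N2 defined_mats_uminus[OF products(1)]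
          defined_mats_append_rows[OF \<nu> defined_mats_one_zero(2)]
          defined_mats_append_rows[OF defined_mats_uminus[OF products(2)] defined_mats_one_zero(1)]]
        defined_mats_four_block[OF \<gamma> defined_mats_one_zero(2) defined_mats_append_rows[OF \<delta> K1]
          defined_mats_append_rows[OF defined_mats_one_zero(1) defined_mats_one_zero(2)]]
        defined_mats_four_block[OF N1t defined_mats_append_cols[OF defined_mats_one_zero(2) \<kappa>]
          defined_mats_uminus[OF products(3)]
          defined_mats_append_cols[OF defined_mats_one_zero(1) defined_mats_uminus[OF products(4)]]])+
  have eqs: "a + k1 = p + ?s" "b + k2 = m + ?s" using sizes by auto
  note app = append_cols_mult_append_rows
  have "R1 * R1' = 1\<^sub>m (a + k1)"
  proof -
    have "\<alpha> * (N2 * \<beta>) + ?K2t * (\<nu> * \<beta>) = (\<alpha> * N2 + ?K2t * \<nu>) * \<beta>"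
      by (simp add: mat_ring_dim)
    then have \<beta>_eq: "\<alpha> * (N2 * \<beta>) + ?K2t * (\<nu> * \<beta>) = \<beta>"
      unfolding idL by (simp add: mat_ring_dim)
    have 1: "(?K2t @\<^sub>c \<beta>) * (\<nu> @\<^sub>r 0\<^sub>m k1 a) = ?K2t * \<nu>"
      by (subst app[of _ a k2 _ k1 _ a]) (simp_all add: carrier_mat_iff mat_ring_dim)
    have 2: "(?K2t @\<^sub>c \<beta>) * (- (\<nu> * \<beta>) @\<^sub>r 1\<^sub>m k1) = - (?K2t * (\<nu> * \<beta>)) + \<beta>"
      by (subst app[of _ a k2 _ k1 _ k1]) (simp_all add: carrier_mat_iff mat_ring_dim)
    have 3: "(0\<^sub>m k1 k2 @\<^sub>c 1\<^sub>m k1) * (\<nu> @\<^sub>r 0\<^sub>m k1 a) = 0\<^sub>m k1 a"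
      by (subst app[of _ k1 k2 _ k1 _ a]) (simp_all add: carrier_mat_iff mat_ring_dim)
    have 4: "(0\<^sub>m k1 k2 @\<^sub>c 1\<^sub>m k1) * (- (\<nu> * \<beta>) @\<^sub>r 1\<^sub>m k1) = 1\<^sub>m k1"
      by (subst app[of _ k1 k2 _ k1 _ k1]) (simp_all add: carrier_mat_iff mat_ring_dim)
    show ?thesis unfolding R1_def R1'_def
      by (subst mult_four_block_mat[of _ a p _ ?s _ k1 _ _ a _ k1])
        (simp_all add: carrier_mat_iff 1 2 3 4 idL mult_one_zero_mat_dim cancel(1)[OF \<beta>_eq, of a k1])
  qed
  from ratmat_invertible_inI(1)[OF dR(1)[unfolded eqs] dR(2)[unfolded eqs] this[unfolded eqs]]
  have inv1: "ratmat_invertible_in \<Omega> R1" .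
  have "R2' * R2 = 1\<^sub>m (b + k2)"
  proof -
    have "\<delta> * (?N1t * \<gamma>) + \<delta> * (\<kappa> * K1) = \<delta> * (?N1t * \<gamma> + \<kappa> * K1)"
      by (simp add: mat_ring_dim)
    then have \<delta>_eq: "\<delta> * (?N1t * \<gamma>) + \<delta> * (\<kappa> * K1) = \<delta>"
      unfolding idR by (simp add: mat_ring_dim)
    have \<delta>_eq': "- (\<delta> * (?N1t * \<gamma>)) + (\<delta> + - (\<delta> * (\<kappa> * K1))) = 0\<^sub>m k2 b"
      by (rule cancel(2)[OF \<delta>_eq]) simp_all
    have 1: "(0\<^sub>m b k2 @\<^sub>c \<kappa>) * (\<delta> @\<^sub>r K1) = \<kappa> * K1"
      by (subst app[of _ b k2 _ k1 _ b]) (simp_all add: carrier_mat_iff mat_ring_dim)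
    have 2: "(0\<^sub>m b k2 @\<^sub>c \<kappa>) * (1\<^sub>m k2 @\<^sub>r 0\<^sub>m k1 k2) = 0\<^sub>m b k2"
      by (subst app[of _ b k2 _ k1 _ k2]) (simp_all add: carrier_mat_iff mat_ring_dim)
    have 3: "(1\<^sub>m k2 @\<^sub>c - (\<delta> * \<kappa>)) * (\<delta> @\<^sub>r K1) = \<delta> + - (\<delta> * (\<kappa> * K1))"
      by (subst app[of _ k2 k2 _ k1 _ b]) (simp_all add: carrier_mat_iff mat_ring_dim)
    have 4: "(1\<^sub>m k2 @\<^sub>c - (\<delta> * \<kappa>)) * (1\<^sub>m k2 @\<^sub>r 0\<^sub>m k1 k2) = 1\<^sub>m k2"
      by (subst app[of _ k2 k2 _ k1 _ k2]) (simp_all add: carrier_mat_iff mat_ring_dim)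
    show ?thesis unfolding R2_def R2'_def
      by (subst mult_four_block_mat[of _ b m _ ?s _ k2 _ _ b _ k2])
        (simp_all add: carrier_mat_iff 1 2 3 4 idR mat_ring_dim \<delta>_eq')
  qed
  from ratmat_invertible_inI(2)[OF dR(4)[unfolded eqs] dR(3)[unfolded eqs] this[unfolded eqs]]
  have inv2: "ratmat_invertible_in \<Omega> R2" .
  let ?R = "N2 * Q * ?N1t"
  have "R1 * four_block_mat ?R (0\<^sub>m p ?s) (0\<^sub>m ?s m) (1\<^sub>m ?s)
      = four_block_mat (\<alpha> * ?R + (?K2t @\<^sub>c \<beta>) * 0\<^sub>m ?s m) (\<alpha> * 0\<^sub>m p ?s + (?K2t @\<^sub>c \<beta>) * 1\<^sub>m ?s)
        (0\<^sub>m k1 p * ?R + (0\<^sub>m k1 k2 @\<^sub>c 1\<^sub>m k1) * 0\<^sub>m ?s m)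
        (0\<^sub>m k1 p * 0\<^sub>m p ?s + (0\<^sub>m k1 k2 @\<^sub>c 1\<^sub>m k1) * 1\<^sub>m ?s)"
    unfolding R1_def
    by (rule mult_four_block_mat[of _ a p _ ?s _ k1 _ _ m _ ?s]) (simp_all add: carrier_mat_iff)
  also have "\<dots> = four_block_mat (\<alpha> * ?R) (?K2t @\<^sub>c \<beta>) (0\<^sub>m k1 m) (0\<^sub>m k1 k2 @\<^sub>c 1\<^sub>m k1)"
    by (simp add: mult_one_zero_mat_dim)
  finally have RD: "R1 * four_block_mat ?R (0\<^sub>m p ?s) (0\<^sub>m ?s m) (1\<^sub>m ?s) = \<dots>" .
  have 1: "(?K2t @\<^sub>c \<beta>) * (\<delta> @\<^sub>r K1) = ?K2t * \<delta> + \<beta> * K1"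
    by (subst app[of _ a k2 _ k1 _ b]) (simp_all add: carrier_mat_iff)
  have 2: "(?K2t @\<^sub>c \<beta>) * (1\<^sub>m k2 @\<^sub>r 0\<^sub>m k1 k2) = ?K2t"
    by (subst app[of _ a k2 _ k1 _ k2]) (simp_all add: carrier_mat_iff mat_ring_dim)
  have 3: "(0\<^sub>m k1 k2 @\<^sub>c 1\<^sub>m k1) * (\<delta> @\<^sub>r K1) = K1"
    by (subst app[of _ k1 k2 _ k1 _ b]) (simp_all add: carrier_mat_iff mat_ring_dim)
  have 4: "(0\<^sub>m k1 k2 @\<^sub>c 1\<^sub>m k1) * (1\<^sub>m k2 @\<^sub>r 0\<^sub>m k1 k2) = (0\<^sub>m k1 k2 :: 'a poly fract mat)"
    by (subst app[of _ k1 k2 _ k1 _ k2]) (simp_all add: carrier_mat_iff mat_ring_dim)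
  have "four_block_mat (\<alpha> * ?R) (?K2t @\<^sub>c \<beta>) (0\<^sub>m k1 m) (0\<^sub>m k1 k2 @\<^sub>c 1\<^sub>m k1) * R2
      = four_block_mat (\<alpha> * ?R * \<gamma> + (?K2t * \<delta> + \<beta> * K1)) ?K2t K1 (0\<^sub>m k1 k2)"
    unfolding R2_def
    by (subst mult_four_block_mat[of _ a m _ ?s _ k1 _ _ b _ k2])
      (simp_all add: carrier_mat_iff 1 2 3 4 mult_one_zero_mat_dim)
  also have "\<alpha> * ?R * \<gamma> + (?K2t * \<delta> + \<beta> * K1) = Q"
  proof -
    have "Q = (\<alpha> * N2 + ?K2t * \<nu>) * Q" unfolding idL by (simp add: mat_ring_dim)
    also have "\<dots> = \<alpha> * (N2 * Q) + ?K2t * \<delta>" by (simp add: mat_ring_dim \<delta>_def)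
    also have "\<alpha> * (N2 * Q) = \<alpha> * (N2 * Q) * (?N1t * \<gamma> + \<kappa> * K1)"
      unfolding idR by (simp add: mat_ring_dim)
    also have "\<dots> = \<alpha> * ?R * \<gamma> + \<beta> * K1" by (simp add: mat_ring_dim \<beta>_def)
    also have "\<alpha> * ?R * \<gamma> + \<beta> * K1 + ?K2t * \<delta> = \<alpha> * ?R * \<gamma> + (?K2t * \<delta> + \<beta> * K1)"
      by (rule add_rotate) simp_all
    finally show ?thesis by (rule sym)
  qed
  finally have "R1 * four_block_mat ?R (0\<^sub>m p ?s) (0\<^sub>m ?s m) (1\<^sub>m ?s) * R2
      = four_block_mat Q ?K2t K1 (0\<^sub>m k1 k2)" unfolding RD .
  with dR(1,3)[THEN defined_matsD(1), unfolded eqs] inv1 inv2 show ?thesis by (intro that)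
qed

section \<open>The linearization\<close>

lemma mat_inverse_regular:
  fixes A :: "'a::field poly mat"
  assumes A: "A \<in> carrier_mat n n" and reg: "regular_mat A"
  shows "the (mat_inverse (rat_of_polymat A)) \<in> carrier_mat n n"
    "rat_of_polymat A * the (mat_inverse (rat_of_polymat A)) = 1\<^sub>m n"
    "the (mat_inverse (rat_of_polymat A)) * rat_of_polymat A = 1\<^sub>m n"
proof -
  interpret comm_ring_hom "to_fract :: 'a poly \<Rightarrow> 'a poly fract"
    by unfold_locales simp_all
  have rA: "rat_of_polymat A \<in> carrier_mat n n" using A by (simp add: rat_of_polymat_def)
  have "det (rat_of_polymat A) \<noteq> 0"
    using reg by (simp add: rat_of_polymat_def regular_mat_def)
  then have "rat_of_polymat A \<in> Units (ring_mat TYPE('a poly fract) n ())"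
    using det_non_zero_imp_unit[OF rA] by simp
  then obtain X where "mat_inverse (rat_of_polymat A) = Some X"
    using mat_inverse(1)[OF rA, of "()"] by blast
  then show "the (mat_inverse (rat_of_polymat A)) \<in> carrier_mat n n"
    "rat_of_polymat A * the (mat_inverse (rat_of_polymat A)) = 1\<^sub>m n"
    "the (mat_inverse (rat_of_polymat A)) * rat_of_polymat A = 1\<^sub>m n"
    using mat_inverse(2)[OF rA] by auto
qed

lemma transfer_function_bordered:
  fixes A B C M K1 K2 :: "'a::field poly mat"
  assumes A: "A \<in> carrier_mat n n" and B: "B \<in> carrier_mat n b" and C: "C \<in> carrier_mat a n"
    and M: "M \<in> carrier_mat a b" and K1: "K1 \<in> carrier_mat k1 b" and K2: "K2 \<in> carrier_mat k2 a"
    and reg: "regular_mat A"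
  shows "transfer_function A (B @\<^sub>c 0\<^sub>m n k2) (C @\<^sub>r 0\<^sub>m k1 n)
      (four_block_mat M (transpose_mat K2) K1 (0\<^sub>m k1 k2))
    = four_block_mat (transfer_function A B C M) (transpose_mat (rat_of_polymat K2))
        (rat_of_polymat K1) (0\<^sub>m k1 k2)"
proof -
  let ?Ai = "the (mat_inverse (rat_of_polymat A))"
  let ?rB = "rat_of_polymat B" and ?rC = "rat_of_polymat C"
  note Ai = mat_inverse_regular(1)[OF A reg]
  have rB: "?rB \<in> carrier_mat n b" and rC: "?rC \<in> carrier_mat a n"
    using B C by (auto simp: rat_of_polymat_def)
  have AiB: "?Ai * ?rB \<in> carrier_mat n b" using Ai rB by simp
  have z: "map_mat to_fract (0\<^sub>m r q :: 'a poly mat) = 0\<^sub>m r q" for r q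
    by (intro eq_matI) auto
  have rB': "rat_of_polymat (B @\<^sub>c 0\<^sub>m n k2) = ?rB @\<^sub>c 0\<^sub>m n k2"
    using B unfolding rat_of_polymat_def by (simp add: map_mat_append_cols z)
  have rC': "rat_of_polymat (C @\<^sub>r 0\<^sub>m k1 n) = ?rC @\<^sub>r 0\<^sub>m k1 n"
    using C unfolding rat_of_polymat_def by (simp add: map_mat_append_rows z)
  have rL: "rat_of_polymat (four_block_mat M (transpose_mat K2) K1 (0\<^sub>m k1 k2))
      = four_block_mat (rat_of_polymat M) (transpose_mat (rat_of_polymat K2)) (rat_of_polymat K1) (0\<^sub>m k1 k2)"
    using M K1 K2 unfolding rat_of_polymat_def by (intro eq_matI) auto
  have "(?rC @\<^sub>r 0\<^sub>m k1 n) * ?Ai * (?rB @\<^sub>c 0\<^sub>m n k2) = (?rC @\<^sub>r 0\<^sub>m k1 n) * (?Ai * (?rB @\<^sub>c 0\<^sub>m n k2))"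
    using rB rC Ai by (intro assoc_mult_mat_dim) auto
  also have "?Ai * (?rB @\<^sub>c 0\<^sub>m n k2) = ?Ai * ?rB @\<^sub>c 0\<^sub>m n k2"
    using mult_append_cols[OF Ai rB zero_carrier_mat] Ai by simp
  also have "(?rC @\<^sub>r 0\<^sub>m k1 n) * (?Ai * ?rB @\<^sub>c 0\<^sub>m n k2)
      = four_block_mat (?rC * (?Ai * ?rB)) (0\<^sub>m a k2) (0\<^sub>m k1 b) (0\<^sub>m k1 k2)"
    unfolding append_rows_mult_append_cols[OF rC zero_carrier_mat AiB zero_carrier_mat]
      left_mult_zero_mat[OF AiB] using rC by simp
  also have "?rC * (?Ai * ?rB) = ?rC * ?Ai * ?rB"
    using rB rC Ai by (intro assoc_mult_mat_dim[symmetric]) auto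
  finally show ?thesis
    unfolding transfer_function_def rB' rC' rL
    using M K1 K2 rB rC Ai by (intro eq_matI) (auto simp: rat_of_polymat_def)
qed

theorem theorem3p2:
  fixes A B C M K1 K2 L LL :: "'a::alg_closed_field poly mat"
    and N1 N2 :: "'a poly fract mat"
    and \<Omega> :: "'a set"
    and n a b k1 k2 :: nat
  assumes dims: "n > 0" "A \<in> carrier_mat n n" "B \<in> carrier_mat n b" "C \<in> carrier_mat a n"
      "M \<in> carrier_mat a b" "K1 \<in> carrier_mat k1 b" "K2 \<in> carrier_mat k2 a"
    and L: "L = four_block_mat M (transpose_mat K2) K1 (0\<^sub>m k1 k2)"
    and LL: "LL = four_block_mat A (B @\<^sub>c 0\<^sub>m n k2) ((- C) @\<^sub>r 0\<^sub>m k1 n) L"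
    and linear: "linear_polymat LL"
    and nonconstant: "nonconstant_polymat LL"
    and regular: "regular_mat A"
    and pencil: "block_full_rank_pencil L M K1 K2"
    and dual1: "dual_rational_bases N1 (rat_of_polymat K1)"
    and dual2: "dual_rational_bases N2 (rat_of_polymat K2)"
    and Omega: "\<Omega> \<noteq> {}"
    and K1_rank: "full_row_rank_in \<Omega> (rat_of_polymat K1)"
    and K2_rank: "full_row_rank_in \<Omega> (rat_of_polymat K2)"
    and N1_rank: "full_row_rank_in \<Omega> N1"
    and N2_rank: "full_row_rank_in \<Omega> N2"
    and rank_col: "\<And>l. l \<in> \<Omega> \<Longrightarrow>
      mat_rank (polymat_eval A l @\<^sub>r (- (ratmat_eval N2 l * polymat_eval C l))) = n"
    and rank_row: "\<And>l. l \<in> \<Omega> \<Longrightarrow>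
      mat_rank (polymat_eval A l @\<^sub>c (polymat_eval B l * transpose_mat (ratmat_eval N1 l))) = n"
  shows "is_linearization_in \<Omega> LL A
    (N2 * (rat_of_polymat M
        + rat_of_polymat C * the (mat_inverse (rat_of_polymat A)) * rat_of_polymat B)
      * transpose_mat N1)"
proof -
  let ?Ai = "the (mat_inverse (rat_of_polymat A))"
  let ?rB = "rat_of_polymat B" and ?rC = "rat_of_polymat C" and ?rM = "rat_of_polymat M"
  let ?rK1 = "rat_of_polymat K1" and ?rK2 = "rat_of_polymat K2" and ?rA = "rat_of_polymat A"
  let ?B = "B @\<^sub>c 0\<^sub>m n k2" and ?C = "C @\<^sub>r 0\<^sub>m k1 n"
  define p m where "p = dim_row N2" and "m = dim_row N1"
  define Q where "Q = ?rM + ?rC * ?Ai * ?rB"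
  note Ai = mat_inverse_regular[OF dims(2) regular]
  have rK: "dim_row ?rK1 = k1" "dim_col ?rK1 = b" "dim_row ?rK2 = k2" "dim_col ?rK2 = a"
    using dims by (simp_all add: rat_of_polymat_def)
  have sizes: "m + k1 = b" "p + k2 = a" and N1c: "N1 \<in> carrier_mat m b" and N2c: "N2 \<in> carrier_mat p a"
    and dual: "N1 * transpose_mat ?rK1 = 0\<^sub>m m k1" "N2 * transpose_mat ?rK2 = 0\<^sub>m p k2"
    using dual1 dual2 rK unfolding dual_rational_bases_def m_def p_def by auto
  have N1: "N1 \<in> defined_mats \<Omega> m b" and N2: "N2 \<in> defined_mats \<Omega> p a"
    using N1_rank N2_rank N1c N2c unfolding full_row_rank_in_def defined_mats_def by auto
  note rA = defined_mats_polymat[OF dims(2), of \<Omega>] and rB = defined_mats_polymat[OF dims(3), of \<Omega>]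
    and rC = defined_mats_polymat[OF dims(4), of \<Omega>] and rM = defined_mats_polymat[OF dims(5), of \<Omega>]
    and rK1 = defined_mats_polymat[OF dims(6), of \<Omega>] and rK2 = defined_mats_polymat[OF dims(7), of \<Omega>]
  have d [simp]: "dim_row ?Ai = n" "dim_col ?Ai = n" "dim_row ?rA = n" "dim_col ?rA = n"
    "dim_row ?rB = n" "dim_col ?rB = b" "dim_row ?rC = a" "dim_col ?rC = n"
    "dim_row ?rM = a" "dim_col ?rM = b" "dim_row N1 = m" "dim_col N1 = b" "dim_row N2 = p" "dim_col N2 = a"
    using Ai(1) N1c N2c dims by (auto simp: rat_of_polymat_def)
  have Q: "Q \<in> carrier_mat a b" unfolding Q_def carrier_mat_iff by simp
  obtain E F where E: "E \<in> defined_mats \<Omega> n n" and F: "F \<in> defined_mats \<Omega> n p"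
    and EF: "E * ?rA + F * (N2 * ?rC) = 1\<^sub>m n"
    using bezout_of_column_rank[OF dims(2,4) N2 Omega rank_col] by metis
  obtain E' F' where E': "E' \<in> defined_mats \<Omega> n n" and F': "F' \<in> defined_mats \<Omega> m n"
    and EF': "?rA * E' + ?rB * transpose_mat N1 * F' = 1\<^sub>m n"
    using bezout_of_row_rank[OF dims(2,3) N1 Omega rank_row] by metis
  have d' [simp]: "dim_row E = n" "dim_col E = n" "dim_row F = n" "dim_col F = p"
    "dim_row E' = n" "dim_col E' = n" "dim_row F' = m" "dim_col F' = n"
    using E F E' F' by (auto simp: defined_mats_def)
  obtain N1' where N1': "N1' \<in> defined_mats \<Omega> b m" "N1 * N1' = 1\<^sub>m m"
    using full_row_rank_in_imp_right_inverse[OF N1c N1_rank Omega] .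
  obtain N2' where N2': "N2' \<in> defined_mats \<Omega> a p" "N2 * N2' = 1\<^sub>m p"
    using full_row_rank_in_imp_right_inverse[OF N2c N2_rank Omega] .
  obtain K1' where K1': "K1' \<in> defined_mats \<Omega> b k1" "?rK1 * K1' = 1\<^sub>m k1"
    using full_row_rank_in_imp_right_inverse[OF defined_matsD(1)[OF rK1] K1_rank Omega] .
  obtain K2' where K2': "K2' \<in> defined_mats \<Omega> a k2" "?rK2 * K2' = 1\<^sub>m k2"
    using full_row_rank_in_imp_right_inverse[OF defined_matsD(1)[OF rK2] K2_rank Omega] .
  obtain \<alpha> \<nu> where \<alpha>: "\<alpha> \<in> defined_mats \<Omega> a p" and \<nu>: "\<nu> \<in> defined_mats \<Omega> k2 a"
    and idL: "\<alpha> * N2 + transpose_mat ?rK2 * \<nu> = 1\<^sub>m a"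
    and \<nu>C: "\<nu> * ?rC * ?Ai \<in> defined_mats \<Omega> k2 n"
    using complement_regularizing_pole[OF N2 rK2 sizes(2) dual(2) N2' K2' rC
      defined_matsD(1)[OF rA] Ai(1,2) E F EF] .
  \<comment> \<open>the same statement for the transposed system, which exchanges inputs and outputs\<close>
  have tAi: "transpose_mat ?rA * transpose_mat ?Ai = 1\<^sub>m n"
    using Ai(3) by (simp flip: transpose_mult_dim)
  have tEF: "transpose_mat E' * transpose_mat ?rA + transpose_mat F' * (N1 * transpose_mat ?rB) = 1\<^sub>m n"
    using arg_cong[OF EF', of transpose_mat] by (simp add: transpose_add_dim transpose_mult_dim)
  obtain \<gamma> \<kappa> where \<gamma>: "\<gamma> \<in> defined_mats \<Omega> b m" and \<kappa>: "\<kappa> \<in> defined_mats \<Omega> k1 b"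
    and idR: "\<gamma> * N1 + transpose_mat ?rK1 * \<kappa> = 1\<^sub>m b"
    and \<kappa>B: "\<kappa> * transpose_mat ?rB * transpose_mat ?Ai \<in> defined_mats \<Omega> k1 n"
    using complement_regularizing_pole[OF N1 rK1 sizes(1) dual(1) N1' K1' defined_mats_transpose[OF rB]
      _ _ tAi defined_mats_transpose[OF E'] defined_mats_transpose[OF F'] tEF]
      defined_matsD(1)[OF rA] Ai(1) by (metis transpose_carrier_mat)
  have d'' [simp]: "dim_row \<nu> = k2" "dim_col \<nu> = a" "dim_row \<gamma> = b" "dim_col \<gamma> = m"
    "dim_row \<kappa> = k1" "dim_col \<kappa> = b"
    using \<nu> \<gamma> \<kappa> by (auto simp: defined_mats_def)
  have idR': "transpose_mat N1 * transpose_mat \<gamma> + transpose_mat \<kappa> * ?rK1 = 1\<^sub>m b"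
    using arg_cong[OF idR, of transpose_mat] rK by (simp add: transpose_add_dim transpose_mult_dim)
  have "\<nu> * Q = \<nu> * ?rM + \<nu> * ?rC * ?Ai * ?rB"
    unfolding Q_def by (simp add: mat_ring_dim)
  then have \<nu>Q: "\<nu> * Q \<in> defined_mats \<Omega> k2 b"
    using defined_mats_add[OF defined_mats_mult(1)[OF \<nu> rM] defined_mats_mult(1)[OF \<nu>C rB]] by simp
  have "Q * transpose_mat \<kappa>
      = ?rM * transpose_mat \<kappa> + ?rC * transpose_mat (\<kappa> * transpose_mat ?rB * transpose_mat ?Ai)"
    unfolding Q_def by (simp add: mat_ring_dim transpose_mult_dim)
  then have Q\<kappa>: "Q * transpose_mat \<kappa> \<in> defined_mats \<Omega> a k1"
    using defined_mats_add[OF defined_mats_mult(1)[OF rM defined_mats_transpose[OF \<kappa>]]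
      defined_mats_mult(1)[OF rC defined_mats_transpose[OF \<kappa>B]]] by simp
  obtain R1 R2 where R: "R1 \<in> carrier_mat (p + (k2 + k1)) (p + (k2 + k1))" "ratmat_invertible_in \<Omega> R1"
    "R2 \<in> carrier_mat (m + (k2 + k1)) (m + (k2 + k1))" "ratmat_invertible_in \<Omega> R2"
    and eq: "R1 * four_block_mat (N2 * Q * transpose_mat N1) (0\<^sub>m p (k2 + k1)) (0\<^sub>m (k2 + k1) m)
        (1\<^sub>m (k2 + k1)) * R2
      = four_block_mat Q (transpose_mat ?rK2) ?rK1 (0\<^sub>m k1 k2)"
    using schur_block_equivalence[OF Q N1 rK1 N2 rK2 sizes(2,1) \<alpha> \<nu> defined_mats_transpose[OF \<gamma>]
      defined_mats_transpose[OF \<kappa>] idL idR' \<nu>Q Q\<kappa>] .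
  let ?G = "N2 * Q * transpose_mat N1"
  have G: "diag_block_mat [?G, 1\<^sub>m (k2 + k1)]
      = four_block_mat ?G (0\<^sub>m p (k2 + k1)) (0\<^sub>m (k2 + k1) m) (1\<^sub>m (k2 + k1))"
    unfolding diag_block_mat.simps(2)[of ?G] diag_block_mat_singleton by (simp add: Let_def)
  have transfer: "transfer_function A ?B ?C L = four_block_mat Q (transpose_mat ?rK2) ?rK1 (0\<^sub>m k1 k2)"
    unfolding L using transfer_function_bordered[OF dims(2-7) regular]
    by (simp add: Q_def transfer_function_def)
  have diag0: "diag_block_mat [X, 1\<^sub>m 0] = X" for X :: "'a poly fract mat"
    by (intro eq_matI) (auto simp: Let_def)
  have equiv: "R1 * diag_block_mat [?G, 1\<^sub>m (k2 + k1)] * R2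
      = diag_block_mat [transfer_function A ?B ?C L, 1\<^sub>m 0]"
    unfolding diag0 transfer G by (rule eq)
  have dL: "dim_row L = a + k1" "dim_col L = b + k2" unfolding L using dims by auto
  have B': "?B \<in> carrier_mat n (b + k2)" by (rule append_cols_carrier[OF dims(3) zero_carrier_mat])
  have C': "?C \<in> carrier_mat (a + k1) n" by (rule carrier_append_rows[OF dims(4) zero_carrier_mat])
  have system: "polynomial_system_matrix LL A ?B ?C L"
  proof -
    have "- ?C = (- C) @\<^sub>r 0\<^sub>m k1 n"
      using dims by (intro eq_matI) (auto simp: append_rows_def)
    then show ?thesis unfolding polynomial_system_matrix_def
      using regular LL B' C' dims(2) dL by simp
  qed
  have minimal: "minimal_in \<Omega> A ?B ?C"
  proof (rule minimal_inI[OF dims(2) B' C' E _ _ E'])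
    show "F * N2 @\<^sub>c 0\<^sub>m n k1 \<in> defined_mats \<Omega> n (a + k1)"
      by (rule defined_mats_append_cols[OF defined_mats_mult(1)[OF F N2] defined_mats_one_zero(2)])
    show "transpose_mat N1 * F' @\<^sub>r 0\<^sub>m k2 n \<in> defined_mats \<Omega> (b + k2) n"
      by (rule defined_mats_append_rows[OF defined_mats_mult(1)[OF defined_mats_transpose[OF N1] F']
          defined_mats_one_zero(2)])
    have z: "map_mat to_fract (0\<^sub>m r q :: 'a poly mat) = 0\<^sub>m r q" for r q
      by (intro eq_matI) auto
    have rC': "rat_of_polymat ?C = ?rC @\<^sub>r 0\<^sub>m k1 n" and rB': "rat_of_polymat ?B = ?rB @\<^sub>c 0\<^sub>m n k2"
      using dims by (simp_all add: rat_of_polymat_def map_mat_append_rows map_mat_append_cols z)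
    have "(F * N2 @\<^sub>c 0\<^sub>m n k1) * (?rC @\<^sub>r 0\<^sub>m k1 n) = F * (N2 * ?rC)"
      by (subst append_cols_mult_append_rows[of _ n a _ k1 _ n])
        (simp_all add: carrier_mat_iff mat_ring_dim)
    then show "E * ?rA + (F * N2 @\<^sub>c 0\<^sub>m n k1) * rat_of_polymat ?C = 1\<^sub>m n"
      using EF rC' by simp
    have "(?rB @\<^sub>c 0\<^sub>m n k2) * (transpose_mat N1 * F' @\<^sub>r 0\<^sub>m k2 n) = ?rB * transpose_mat N1 * F'"
      by (subst append_cols_mult_append_rows[of _ n b _ k2 _ n])
        (simp_all add: carrier_mat_iff mat_ring_dim)
    then show "?rA * E' + rat_of_polymat ?B * (transpose_mat N1 * F' @\<^sub>r 0\<^sub>m k2 n) = 1\<^sub>m n"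
      using EF' rB' by simp
  qed
  show ?thesis
    unfolding is_linearization_in_def Q_def[symmetric]
  proof (intro exI conjI)
    show "polynomial_system_matrix LL A ?B ?C L" by (rule system)
    show "int (k2 + k1) - int 0 = int (dim_row L) - int (dim_row ?G)"
      "int (k2 + k1) - int 0 = int (dim_col L) - int (dim_col ?G)"
      using sizes dL by simp_all
    show "R1 \<in> carrier_mat (dim_row ?G + (k2 + k1)) (dim_row ?G + (k2 + k1))"
      "R2 \<in> carrier_mat (dim_col ?G + (k2 + k1)) (dim_col ?G + (k2 + k1))"
      using R by simp_all
  qed (fact linear minimal R equiv)+
qed

end
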